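(* Let $\mathbf{A}$ be a finite strongly Fregean algebra. Then $$\delta(\mathsf{Con}(\mathbf{A}))=\sum\{\dim\overline{U}: U\in\mathsf{Cm}(\mathbf{A})/\!\sim\},$$ where $\dim\overline{U}$ denotes the dimension of the Boolean group $(\overline{U},\bullet)$ treated as a vector space over the field $\mathbb{Z}_2$.
   Context: Conventions. $\mathsf{Con}(\mathbf{A})$ is the congruence lattice of an algebra $\mathbf{A}$ (congruences are subsets of $A^2$). The length $\delta(L)$ of a finite modular lattice $L$ is the length of an arbitrary maximal chain in $L$, where a chain with $n+1$ elements has length $n$. $\mathsf{Cm}(\mathbf{A})$ is the set of completely meet irreducible congruences; for $\eta\in\mathsf{Cm}(\mathbf{A})$, $\eta^{+}$ denotes the least congruence strictly greater than $\eta$. For $\alpha\le\beta$ in $\mathsf{Con}(\mathbf{A})$ let $I[\alpha,\beta]=\{\gamma:\alpha\le\gamma\le\beta\}$. Write $I[\alpha,\beta]\nearrow I[\gamma,\delta]$ (equivalently $I[\gamma,\delta]\searrow I[\alpha,\beta]$) if $\beta\wedge\gamma=\alpha$ and $\beta\vee\gamma=\delta$. Two intervals are projective if they are connected by a finite sequence of steps $\nearrow,\searrow$. When $\mathsf{Con}(\mathbf{A})$ is modular, for $\varphi,\psi\in\mathsf{Cm}(\mathbf{A})$ put $\varphi\sim\psi$ iff $I[\varphi,\varphi^{+}]$ and $I[\psi,\psi^{+}]$ are projective; this is an equivalence relation. The language contains a distinguished constant term $1$. $\Theta_{\mathbf{A}}(c,d)$ is the least congruence containing $(c,d)$. $\mathbf{A}$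 is congruence orderable if $\Theta_{\mathbf{A}}(1,a)=\Theta_{\mathbf{A}}(1,b)$ implies $a=b$ for $a,b\in A$; it is $1$-regular if $1/\alpha=1/\beta$ implies $\alpha=\beta$ for $\alpha,\beta\in\mathsf{Con}(\mathbf{A})$; it is Fregean if it is both. $\mathbf{A}$ is strongly Fregean if every homomorphic image of $\mathbf{A}$ is Fregean (with respect to $1$) and the variety generated by $\mathbf{A}$ is congruence modular. For strongly Fregean $\mathbf{A}$, $\varphi\sim\psi$ implies $\varphi^{+}=\psi^{+}$. For $U=\eta/\!\sim$ put $\overline{U}:=U\cup\{\eta^{+}\}$ (independent of the choice of $\eta\in U$), and for $\varphi,\psi\in\overline{U}$ put $\varphi\bullet\psi:=(\varphi\div\psi)'\cap\eta^{+}$, where $\div$ is symmetric difference and $'$ is complement in $A^2$. Then $(\overline{U},\bullet)$ is a Boolean group (every element is its own inverse) with unit $\eta^{+}$. *)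

theory Defs
  imports
    "HOL-Algebra.Algebra"
    "HOL-Number_Theory.Residues"
    "Jordan_Normal_Form.Missing_VectorSpace"
begin

section \<open>Algebras and terms\<close>

text \<open>
  The language has the elements of the type \<open>'f\<close> as operation symbols; \<open>ar f\<close> is the arity
  of \<open>f\<close>. The value of \<open>interp A f\<close> matters only on lists of length \<open>ar f\<close> over the carrier.
\<close>

record ('f, 'a) ualg = "'a partial_object" +
  interp :: "'f \<Rightarrow> 'a list \<Rightarrow> 'a"

definition ualgebra :: "('f \<Rightarrow> nat) \<Rightarrow> ('f, 'a) ualg \<Rightarrow> bool" where
  "ualgebra ar A \<longleftrightarrow> carrier A \<noteq> {} \<and>
     (\<forall>f xs. length xs = ar f \<and> set xs \<subseteq> carrier A \<longrightarrow> interp A f xs \<in> carrier A)"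

datatype 'f trm = Var nat | Fun 'f "'f trm list"

fun wf_trm :: "('f \<Rightarrow> nat) \<Rightarrow> 'f trm \<Rightarrow> bool" where
  "wf_trm ar (Var i) \<longleftrightarrow> True"
| "wf_trm ar (Fun f ts) \<longleftrightarrow> length ts = ar f \<and> (\<forall>t \<in> set ts. wf_trm ar t)"

fun eval_trm :: "('f, 'a) ualg \<Rightarrow> (nat \<Rightarrow> 'a) \<Rightarrow> 'f trm \<Rightarrow> 'a" where
  "eval_trm A \<rho> (Var i) = \<rho> i"
| "eval_trm A \<rho> (Fun f ts) = interp A f (map (eval_trm A \<rho>) ts)"

definition satisfies :: "('f, 'a) ualg \<Rightarrow> 'f trm \<Rightarrow> 'f trm \<Rightarrow> bool" where
  "satisfies A s t \<longleftrightarrow> (\<forall>\<rho>. range \<rho> \<subseteq> carrier A \<longrightarrow> eval_trm A \<rho> s = eval_trm A \<rho> t)"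

text \<open>
  A constant term is a term whose value does not depend on the valuation. This covers nullary
  symbols and closed terms as well as terms such as \<open>x \<rightarrow> x\<close> in Hilbert algebras.
\<close>

definition constant_trm :: "('f \<Rightarrow> nat) \<Rightarrow> ('f, 'a) ualg \<Rightarrow> 'f trm \<Rightarrow> bool" where
  "constant_trm ar A t \<longleftrightarrow> wf_trm ar t \<and>
     (\<forall>\<rho> \<rho>'. range \<rho> \<subseteq> carrier A \<and> range \<rho>' \<subseteq> carrier A \<longrightarrow> eval_trm A \<rho> t = eval_trm A \<rho>' t)"

definition const_val :: "('f, 'a) ualg \<Rightarrow> 'f trm \<Rightarrow> 'a" where
  "const_val A t = (THE c. \<forall>\<rho>. range \<rho> \<subseteq> carrier A \<longrightarrow> eval_trm A \<rho> t = c)"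

definition surj_hom :: "('f \<Rightarrow> nat) \<Rightarrow> ('f, 'a) ualg \<Rightarrow> ('f, 'b) ualg \<Rightarrow> ('a \<Rightarrow> 'b) \<Rightarrow> bool" where
  "surj_hom ar A B h \<longleftrightarrow> h ` carrier A = carrier B \<and>
     (\<forall>f xs. length xs = ar f \<and> set xs \<subseteq> carrier A \<longrightarrow>
        h (interp A f xs) = interp B f (map h xs))"


section \<open>Lattice notions\<close>

locale modular_lattice = lattice +
  assumes modular: "\<lbrakk>x \<in> carrier L; y \<in> carrier L; z \<in> carrier L; x \<sqsubseteq> z\<rbrakk> \<Longrightarrow>
    x \<squnion> (y \<sqinter> z) = (x \<squnion> y) \<sqinter> z"

text \<open>The length of a lattice, read off from an arbitrary maximal chain.\<close>

definition lattice_length :: "('a, 'b) gorder_scheme \<Rightarrow> nat" where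
  "lattice_length L = card (SOME C. pred_on.maxchain (carrier L) (le L) C) - 1"

text \<open>The case \<open>S = {}\<close> excludes the top element.\<close>

definition Cm :: "('a, 'b) gorder_scheme \<Rightarrow> 'a set" where
  "Cm L = {\<eta> \<in> carrier L. \<forall>S. S \<subseteq> carrier L \<and> \<eta> = \<Sqinter>\<^bsub>L\<^esub>S \<longrightarrow> \<eta> \<in> S}"

definition upper_cover :: "('a, 'b) gorder_scheme \<Rightarrow> 'a \<Rightarrow> 'a" where
  "upper_cover L \<eta> = (THE \<theta>. least L \<theta> {\<theta> \<in> carrier L. \<eta> \<sqsubset>\<^bsub>L\<^esub> \<theta>})"

text \<open>Here an interval is represented by the pair of its end points.\<close>

definition transposes_up :: "('a, 'b) gorder_scheme \<Rightarrow> 'a \<times> 'a \<Rightarrow> 'a \<times> 'a \<Rightarrow> bool" where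
  "transposes_up L I J \<longleftrightarrow> (case I of (\<alpha>, \<beta>) \<Rightarrow> case J of (\<gamma>, \<delta>) \<Rightarrow>
     {\<alpha>, \<beta>, \<gamma>, \<delta>} \<subseteq> carrier L \<and> \<alpha> \<sqsubseteq>\<^bsub>L\<^esub> \<beta> \<and> \<gamma> \<sqsubseteq>\<^bsub>L\<^esub> \<delta> \<and>
     \<beta> \<sqinter>\<^bsub>L\<^esub> \<gamma> = \<alpha> \<and> \<beta> \<squnion>\<^bsub>L\<^esub> \<gamma> = \<delta>)"

definition projective :: "('a, 'b) gorder_scheme \<Rightarrow> 'a \<times> 'a \<Rightarrow> 'a \<times> 'a \<Rightarrow> bool" where
  "projective L = equivclp (transposes_up L)"

definition Cm_sim :: "('a, 'b) gorder_scheme \<Rightarrow> ('a \<times> 'a) set" where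
  "Cm_sim L = {(\<phi>, \<psi>) \<in> Cm L \<times> Cm L.
     projective L (\<phi>, upper_cover L \<phi>) (\<psi>, upper_cover L \<psi>)}"


section \<open>Congruences and Fregean algebras\<close>

definition congruences :: "('f \<Rightarrow> nat) \<Rightarrow> ('f, 'a) ualg \<Rightarrow> 'a rel set" where
  "congruences ar A = {\<theta>. equiv (carrier A) \<theta> \<and>
     (\<forall>f xs ys. length xs = ar f \<and> list_all2 (\<lambda>x y. (x, y) \<in> \<theta>) xs ys \<longrightarrow>
        (interp A f xs, interp A f ys) \<in> \<theta>)}"

definition Con :: "('f \<Rightarrow> nat) \<Rightarrow> ('f, 'a) ualg \<Rightarrow> 'a rel gorder" where
  "Con ar A = \<lparr>carrier = congruences ar A, eq = (=), le = (\<subseteq>)\<rparr>"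

definition principal_congruence :: "('f \<Rightarrow> nat) \<Rightarrow> ('f, 'a) ualg \<Rightarrow> 'a \<Rightarrow> 'a \<Rightarrow> 'a rel" where
  "principal_congruence ar A c d = \<Inter>{\<theta> \<in> congruences ar A. (c, d) \<in> \<theta>}"

definition congruence_orderable :: "('f \<Rightarrow> nat) \<Rightarrow> 'f trm \<Rightarrow> ('f, 'a) ualg \<Rightarrow> bool" where
  "congruence_orderable ar u A \<longleftrightarrow> (\<forall>a \<in> carrier A. \<forall>b \<in> carrier A.
     principal_congruence ar A (const_val A u) a = principal_congruence ar A (const_val A u) b
       \<longrightarrow> a = b)"

definition point_regular :: "('f \<Rightarrow> nat) \<Rightarrow> 'f trm \<Rightarrow> ('f, 'a) ualg \<Rightarrow> bool" where
  "point_regular ar u A \<longleftrightarrow> (\<forall>\<alpha> \<in> congruences ar A. \<forall>\<beta> \<in> congruences ar A.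
     \<alpha> `` {const_val A u} = \<beta> `` {const_val A u} \<longrightarrow> \<alpha> = \<beta>)"

definition Fregean :: "('f \<Rightarrow> nat) \<Rightarrow> 'f trm \<Rightarrow> ('f, 'a) ualg \<Rightarrow> bool" where
  "Fregean ar u A \<longleftrightarrow> congruence_orderable ar u A \<and> point_regular ar u A"

text \<open>
  The variety generated by \<open>A\<close> is the least equational class containing \<open>A\<close>, i.e. the class of
  all models of the identities of \<open>A\<close>.
\<close>

definition in_generated_variety ::
    "('f \<Rightarrow> nat) \<Rightarrow> ('f, 'a) ualg \<Rightarrow> ('f, 'b) ualg \<Rightarrow> bool" where
  "in_generated_variety ar A B \<longleftrightarrow> ualgebra ar B \<and>
     (\<forall>s t. wf_trm ar s \<and> wf_trm ar t \<and> satisfies A s t \<longrightarrow> satisfies B s t)"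

text \<open>
  A HOL definition cannot quantify over the carrier types of the members of the variety, so it
  ranges over the algebras with carrier in \<^typ>\<open>nat\<close>. For finite \<open>A\<close> this loses nothing: a failure
  of modularity in a congruence lattice is witnessed by finitely many elements, hence occurs in a
  finitely generated subalgebra, and finitely generated members of the variety generated by a
  finite algebra are finite. (As part of a hypothesis, the restriction can in any case only make
  that hypothesis weaker.)
\<close>

definition generates_congruence_modular :: "('f \<Rightarrow> nat) \<Rightarrow> ('f, 'a) ualg \<Rightarrow> bool" where
  "generates_congruence_modular ar A \<longleftrightarrow>
     (\<forall>B :: ('f, nat) ualg. in_generated_variety ar A B \<longrightarrow> modular_lattice (Con ar B))"

text \<open>
  Every homomorphic image of \<open>A\<close> is isomorphic to one with carrier in the type of \<open>A\<close>
  (choose one preimage for each element), so \<open>B\<close> below ranges over all of them up to isomorphism.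
\<close>

definition strongly_Fregean :: "('f \<Rightarrow> nat) \<Rightarrow> 'f trm \<Rightarrow> ('f, 'a) ualg \<Rightarrow> bool" where
  "strongly_Fregean ar u A \<longleftrightarrow> ualgebra ar A \<and> constant_trm ar A u \<and>
     (\<forall>(B :: ('f, 'a) ualg) h. ualgebra ar B \<and> surj_hom ar A B h \<longrightarrow> Fregean ar u B) \<and>
     generates_congruence_modular ar A"


section \<open>The Boolean groups\<close>

text \<open>For a class \<open>U\<close> of \<^const>\<open>Cm_sim\<close> in a strongly Fregean algebra, all elements of \<open>U\<close> have
  the same upper cover.\<close>

definition class_cover :: "('f \<Rightarrow> nat) \<Rightarrow> ('f, 'a) ualg \<Rightarrow> 'a rel set \<Rightarrow> 'a rel" where
  "class_cover ar A U = upper_cover (Con ar A) (SOME \<eta>. \<eta> \<in> U)"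

definition bullet ::
    "('f \<Rightarrow> nat) \<Rightarrow> ('f, 'a) ualg \<Rightarrow> 'a rel set \<Rightarrow> 'a rel \<Rightarrow> 'a rel \<Rightarrow> 'a rel" where
  "bullet ar A U \<phi> \<psi> =
     (carrier A \<times> carrier A - ((\<phi> - \<psi>) \<union> (\<psi> - \<phi>))) \<inter> class_cover ar A U"

text \<open>
  The Boolean group on \<open>U \<union> {\<eta>\<^sup>+}\<close> with its unique scalar multiplication by the elements
  \<open>0, 1\<close> of \<open>residue_ring 2\<close>. The fields \<open>mult\<close> and \<open>one\<close> of the module record play no role.
\<close>

definition boolean_space ::
    "('f \<Rightarrow> nat) \<Rightarrow> ('f, 'a) ualg \<Rightarrow> 'a rel set \<Rightarrow> (int, 'a rel) module" where
  "boolean_space ar A U =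
     \<lparr>carrier = U \<union> {class_cover ar A U},
      monoid.mult = undefined,
      one = undefined,
      ring.zero = class_cover ar A U,
      ring.add = bullet ar A U,
      smult = \<lambda>c \<phi>. if c = 0 then class_cover ar A U else \<phi>\<rparr>"

end

theory Submission
  imports Defs
begin

text \<open>
  Why the theorem holds. Climb a maximal chain of \<open>Con A\<close> from the bottom, and at each congruence
  \<open>\<theta>\<close> look, for every projectivity class \<open>U\<close>, at the subgroup of \<open>U \<union> {\<eta>\<^sup>+}\<close> formed by the unit and the
  members of \<open>U\<close> above \<open>\<theta>\<close>. Let \<open>\<alpha> \<prec> \<beta>\<close> be a step of the chain. The meet irreducibles \<open>\<eta>\<close> that lie
  above \<open>\<alpha>\<close> but not above \<open>\<beta>\<close> are those for which \<open>I[\<alpha>, \<beta>]\<close> transposes up to \<open>I[\<eta>, \<eta>\<^sup>+]\<close>. They exist, and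
  they all belong to one class. The subgroup of that class loses half of its elements: if \<open>\<eta>\<close> and \<open>\<eta>'\<close> both drop
  out, then they agree on \<open>\<beta>\<close>, so \<open>\<eta> \<bullet> \<eta>'\<close> contains \<open>\<beta>\<close>. The subgroups of the other classes do not change. Hence
  the product of the orders of the subgroups is halved at each step. It is \<open>2\<close> to the sum of the dimensions at
  the bottom, and \<open>1\<close> at the top (\<open>card_maximal_chain\<close>).

  This presupposes that every \<open>U \<union> {\<eta>\<^sup>+}\<close> is a group, in particular that \<open>\<phi> \<bullet> \<psi>\<close> is a congruence for
  \<open>\<phi> \<sim> \<psi>\<close>. Congruence orderability of quotients makes the congruences near a cover rigid: in \<open>A/\<alpha>\<close> an
  atom adds only one element to the class of \<open>1\<close> (\<open>covered_by_two_classes\<close>), and the cover of a meet irreducible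
  \<open>\<eta>\<close> differs from \<open>\<eta>\<close> only on its own class of \<open>1\<close> (\<open>cover_trivial_off_unit_class\<close>). Call \<open>\<phi>\<close> and \<open>\<psi>\<close>
  linked if a single interval \<open>I[\<alpha>, \<beta>]\<close> transposes up to both of their covers. In that case the two covers
  are equal (\<open>linked_cover_eq\<close>), and if \<open>\<phi> \<noteq> \<psi>\<close>, the congruence \<open>(\<phi> \<and> \<psi>) \<or> \<beta>\<close> is the third atom of a diamond
  with atoms \<open>\<phi>\<close> and \<open>\<psi>\<close>; by the rigidity it equals \<open>\<phi> \<bullet> \<psi>\<close> (\<open>linked_agree\<close>). Moreover being linked is
  transitive (\<open>linked_trans\<close>), and therefore the same as projectivity (\<open>Cm_sim_iff_linked\<close>).

  The equality of the covers is the point where congruence modularity of the variety is needed, and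
  not only that of \<open>Con A\<close>. If the covers of \<open>\<phi>\<close> and \<open>\<psi>\<close> differed, the join of \<open>\<phi>\<close> and \<open>\<psi>\<close>
  would contain \<open>\<beta>\<close> although \<open>\<beta>\<close> meets both in \<open>\<alpha>\<close>, that is, \<open>\<beta>\<close> would be abelian over \<open>\<alpha>\<close>. In a
  congruence modular variety abelian congruences permute with all others, and the element that
  permutability provides contradicts the rigidity. The lemma \<open>modular_corner\<close> obtains this element directly from
  the modular law for the congruences of one subalgebra of \<open>A\<^sup>5\<close>.
\<close>

section \<open>Congruences of an arbitrary algebra\<close>

lemma congruenceD:
  assumes "\<theta> \<in> congruences ar A"
  shows congruence_subset: "\<theta> \<subseteq> carrier A \<times> carrier A"
    and congruence_refl: "x \<in> carrier A \<Longrightarrow> (x, x) \<in> \<theta>"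
    and congruence_sym: "(x, y) \<in> \<theta> \<Longrightarrow> (y, x) \<in> \<theta>"
    and congruence_trans: "(x, y) \<in> \<theta> \<Longrightarrow> (y, z) \<in> \<theta> \<Longrightarrow> (x, z) \<in> \<theta>"
    and congruence_compat: "length xs = ar f \<Longrightarrow> list_all2 (\<lambda>x y. (x, y) \<in> \<theta>) xs ys \<Longrightarrow>
        (interp A f xs, interp A f ys) \<in> \<theta>"
proof -
  have *: "equiv (carrier A) \<theta>" "\<And>f xs ys. length xs = ar f \<Longrightarrow>
      list_all2 (\<lambda>x y. (x, y) \<in> \<theta>) xs ys \<Longrightarrow> (interp A f xs, interp A f ys) \<in> \<theta>"
    using assms by (simp_all add: congruences_def)
  show "\<theta> \<subseteq> carrier A \<times> carrier A" "x \<in> carrier A \<Longrightarrow> (x, x) \<in> \<theta>"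
    using *(1) by (auto simp: equiv_def refl_on_def)
  show "(x, y) \<in> \<theta> \<Longrightarrow> (y, x) \<in> \<theta>"
    using *(1) by (auto simp: equiv_def elim: symE)
  show "(x, y) \<in> \<theta> \<Longrightarrow> (y, z) \<in> \<theta> \<Longrightarrow> (x, z) \<in> \<theta>"
    using *(1) unfolding equiv_def by (blast dest: transD)
  show "length xs = ar f \<Longrightarrow> list_all2 (\<lambda>x y. (x, y) \<in> \<theta>) xs ys \<Longrightarrow>
        (interp A f xs, interp A f ys) \<in> \<theta>"
    by (rule *(2))
qed

lemma congruence_carrier:
  assumes "\<theta> \<in> congruences ar A" "(x, y) \<in> \<theta>"
  shows "x \<in> carrier A" "y \<in> carrier A"
  using congruence_subset[OF assms(1)] assms(2) by auto

lemma congruenceI: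
  assumes "\<theta> \<subseteq> carrier A \<times> carrier A"
    and "\<And>x. x \<in> carrier A \<Longrightarrow> (x, x) \<in> \<theta>"
    and "\<And>x y. (x, y) \<in> \<theta> \<Longrightarrow> (y, x) \<in> \<theta>"
    and "\<And>x y z. (x, y) \<in> \<theta> \<Longrightarrow> (y, z) \<in> \<theta> \<Longrightarrow> (x, z) \<in> \<theta>"
    and "\<And>f xs ys. length xs = ar f \<Longrightarrow> list_all2 (\<lambda>x y. (x, y) \<in> \<theta>) xs ys \<Longrightarrow>
        (interp A f xs, interp A f ys) \<in> \<theta>"
  shows "\<theta> \<in> congruences ar A"
proof -
  have "equiv (carrier A) \<theta>"
    by (intro equivI refl_onI symI transI assms(1)) (fact assms(2-4))+
  then show ?thesis using assms(5) by (simp add: congruences_def)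
qed

lemma interp_closed:
  "ualgebra ar A \<Longrightarrow> length xs = ar f \<Longrightarrow> set xs \<subseteq> carrier A \<Longrightarrow> interp A f xs \<in> carrier A"
  by (simp add: ualgebra_def)

lemma list_all2_carrier:
  assumes "list_all2 (\<lambda>x y. (x, y) \<in> \<theta>) xs ys" "\<theta> \<subseteq> S \<times> S"
  shows "set xs \<subseteq> S" "set ys \<subseteq> S"
  using assms by (induction rule: list_all2_induct) auto

lemma full_congruence:
  assumes "ualgebra ar A"
  shows "carrier A \<times> carrier A \<in> congruences ar A"
proof (rule congruenceI)
  fix f xs ys
  assume "length xs = ar f" "list_all2 (\<lambda>x y. (x, y) \<in> carrier A \<times> carrier A) xs ys"
  then show "(interp A f xs, interp A f ys) \<in> carrier A \<times> carrier A"
    using interp_closed[OF assms, of _ f] list_all2_carrier[of "carrier A \<times> carrier A" xs ys "carrier A"]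
      list_all2_lengthD[of _ xs ys] by simp
qed auto

lemma identity_congruence:
  assumes "ualgebra ar A"
  shows "Id_on (carrier A) \<in> congruences ar A"
proof (rule congruenceI)
  fix f xs ys
  assume l: "length xs = ar f" and r: "list_all2 (\<lambda>x y. (x, y) \<in> Id_on (carrier A)) xs ys"
  have "list_all2 (=) xs ys" by (rule list_all2_mono[OF r]) auto
  then have "xs = ys" by (simp add: list.rel_eq)
  moreover have "set xs \<subseteq> carrier A"
    by (rule list_all2_carrier[OF r]) auto
  ultimately show "(interp A f xs, interp A f ys) \<in> Id_on (carrier A)"
    using interp_closed[OF assms l] by auto
qed auto

lemma identity_subset_congruence:
  "\<theta> \<in> congruences ar A \<Longrightarrow> Id_on (carrier A) \<subseteq> \<theta>"
  using congruence_refl by fastforce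

lemma Inter_congruence:
  assumes S: "S \<subseteq> congruences ar A" "S \<noteq> {}"
  shows "\<Inter>S \<in> congruences ar A"
proof (rule congruenceI)
  show "(x, x) \<in> \<Inter>S" if "x \<in> carrier A" for x
    using S(1) congruence_refl[OF _ that] by auto
  show "(y, x) \<in> \<Inter>S" if "(x, y) \<in> \<Inter>S" for x y
    using that S(1) congruence_sym by (meson InterE InterI subsetD)
  show "(x, z) \<in> \<Inter>S" if "(x, y) \<in> \<Inter>S" "(y, z) \<in> \<Inter>S" for x y z
    using that S(1) congruence_trans by (meson InterE InterI subsetD)
  show "\<Inter>S \<subseteq> carrier A \<times> carrier A"
    using S congruence_subset by (metis Inter_lower equals0I order_trans subsetD)

  fix f xs ys
  assume l: "length xs = ar f" and r: "list_all2 (\<lambda>x y. (x, y) \<in> \<Inter>S) xs ys"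
  show "(interp A f xs, interp A f ys) \<in> \<Inter>S"
  proof
    fix \<theta> assume "\<theta> \<in> S"
    with r have "list_all2 (\<lambda>x y. (x, y) \<in> \<theta>) xs ys" by (auto elim: list_all2_mono)
    with l show "(interp A f xs, interp A f ys) \<in> \<theta>"
      using congruence_compat[OF subsetD[OF S(1) \<open>\<theta> \<in> S\<close>]] by simp
  qed
qed

lemma Int_congruence:
  assumes "\<alpha> \<in> congruences ar A" "\<beta> \<in> congruences ar A"
  shows "\<alpha> \<inter> \<beta> \<in> congruences ar A"
  using Inter_congruence[of "{\<alpha>, \<beta>}" ar A] assms by simp

definition cong_join :: "('f \<Rightarrow> nat) \<Rightarrow> ('f, 'a) ualg \<Rightarrow> 'a rel \<Rightarrow> 'a rel \<Rightarrow> 'a rel" where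
  "cong_join ar A \<alpha> \<beta> = \<Inter>{\<theta> \<in> congruences ar A. \<alpha> \<subseteq> \<theta> \<and> \<beta> \<subseteq> \<theta>}"

lemma cong_join_upper: "\<alpha> \<subseteq> cong_join ar A \<alpha> \<beta>" "\<beta> \<subseteq> cong_join ar A \<alpha> \<beta>"
  by (auto simp: cong_join_def)

lemma cong_join_least:
  "\<theta> \<in> congruences ar A \<Longrightarrow> \<alpha> \<subseteq> \<theta> \<Longrightarrow> \<beta> \<subseteq> \<theta> \<Longrightarrow> cong_join ar A \<alpha> \<beta> \<subseteq> \<theta>"
  by (auto simp: cong_join_def)

lemma cong_join_congruence:
  assumes "ualgebra ar A" "\<alpha> \<in> congruences ar A" "\<beta> \<in> congruences ar A"
  shows "cong_join ar A \<alpha> \<beta> \<in> congruences ar A"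
  unfolding cong_join_def using assms full_congruence[OF assms(1)]
  by (intro Inter_congruence) (auto dest: congruence_subset)

text \<open>
  The arguments of an operation can be changed one after the other. Compatibility in each single
  argument is inherited by transitive closures, which is how joins of congruences are found to be congruences.
\<close>

lemma compat_if_compat_in_each_argument:
  assumes A: "ualgebra ar A" and sub: "\<theta> \<subseteq> carrier A \<times> carrier A"
    and trans: "trans \<theta>" and refl: "\<And>x. x \<in> carrier A \<Longrightarrow> (x, x) \<in> \<theta>"
    and one: "\<And>f us vs x y. length us + length vs + 1 = ar f \<Longrightarrow> set us \<subseteq> carrier A \<Longrightarrow>
      set vs \<subseteq> carrier A \<Longrightarrow> (x, y) \<in> \<theta> \<Longrightarrow> (interp A f (us @ x # vs), interp A f (us @ y # vs)) \<in> \<theta>"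
    and len: "length xs = ar f" and rel: "list_all2 (\<lambda>x y. (x, y) \<in> \<theta>) xs ys"
  shows "(interp A f xs, interp A f ys) \<in> \<theta>"
proof -
  have "(interp A f (us @ xs), interp A f (us @ ys)) \<in> \<theta>"
    if "list_all2 (\<lambda>x y. (x, y) \<in> \<theta>) xs ys" "length us + length xs = ar f" "set us \<subseteq> carrier A"
    for us xs ys
    using that
  proof (induction arbitrary: us rule: list_all2_induct)
    case Nil
    then show ?case using interp_closed[OF A] refl by simp
  next
    case (Cons x xs y ys)
    have xy: "x \<in> carrier A" "y \<in> carrier A" using Cons.hyps(1) sub by auto
    have xs: "set xs \<subseteq> carrier A"
      by (rule list_all2_carrier(1)[OF Cons.hyps(2) sub])
    have "(interp A f (us @ x # xs), interp A f (us @ y # xs)) \<in> \<theta>"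
      using Cons xs by (intro one) auto
    moreover have "(interp A f ((us @ [y]) @ xs), interp A f ((us @ [y]) @ ys)) \<in> \<theta>"
      using Cons.prems xy by (intro Cons.IH) auto
    ultimately show ?case using trans by (auto elim: transE)
  qed
  from this[OF rel, of "[]"] len show ?thesis by simp
qed

lemma cong_join_trancl:
  assumes A: "ualgebra ar A" and ab: "\<alpha> \<in> congruences ar A" "\<beta> \<in> congruences ar A"
  shows "cong_join ar A \<alpha> \<beta> = (\<alpha> \<union> \<beta>)\<^sup>+"
proof
  have sub: "(\<alpha> \<union> \<beta>)\<^sup>+ \<subseteq> carrier A \<times> carrier A"
    using ab by (intro trancl_subset_Sigma) (auto dest: congruence_subset)
  have "(\<alpha> \<union> \<beta>)\<^sup>+ \<in> congruences ar A"
  proof (rule congruenceI[OF sub])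
    show refl: "(x, x) \<in> (\<alpha> \<union> \<beta>)\<^sup>+" if "x \<in> carrier A" for x
      using congruence_refl[OF ab(1) that] by auto
    have "sym ((\<alpha> \<union> \<beta>)\<^sup>+)"
      using ab by (intro sym_trancl symI) (auto dest: congruence_sym)
    then show "(y, x) \<in> (\<alpha> \<union> \<beta>)\<^sup>+" if "(x, y) \<in> (\<alpha> \<union> \<beta>)\<^sup>+" for x y
      using that by (auto elim: symE)
    show "(x, z) \<in> (\<alpha> \<union> \<beta>)\<^sup>+" if "(x, y) \<in> (\<alpha> \<union> \<beta>)\<^sup>+" "(y, z) \<in> (\<alpha> \<union> \<beta>)\<^sup>+" for x y z
      using that by (rule trancl_trans)
    have one: "(interp A f (us @ x # vs), interp A f (us @ y # vs)) \<in> \<theta>"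
      if "\<theta> \<in> congruences ar A" "length us + length vs + 1 = ar f" "set us \<subseteq> carrier A"
        "set vs \<subseteq> carrier A" "(x, y) \<in> \<theta>" for \<theta> f us vs x y
    proof (rule congruence_compat[OF that(1)])
      have "list_all2 (\<lambda>x y. (x, y) \<in> \<theta>) zs zs" if "set zs \<subseteq> carrier A" for zs
        using that congruence_refl[OF \<open>\<theta> \<in> congruences ar A\<close>] by (auto intro: list.rel_refl_strong)
      then show "list_all2 (\<lambda>x y. (x, y) \<in> \<theta>) (us @ x # vs) (us @ y # vs)"
        using that by (auto intro!: list_all2_appendI)
    qed (use that in auto)
    fix f xs ys
    assume "length xs = ar f" "list_all2 (\<lambda>x y. (x, y) \<in> (\<alpha> \<union> \<beta>)\<^sup>+) xs ys"
    then show "(interp A f xs, interp A f ys) \<in> (\<alpha> \<union> \<beta>)\<^sup>+"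
    proof (rule compat_if_compat_in_each_argument[OF A sub trans_trancl refl, rotated 2])
      fix f us vs x y
      assume l: "length us + length vs + 1 = ar f" "set us \<subseteq> carrier A" "set vs \<subseteq> carrier A"
        and xy: "(x, y) \<in> (\<alpha> \<union> \<beta>)\<^sup>+"
      have single: "(interp A f (us @ x # vs), interp A f (us @ y # vs)) \<in> \<alpha> \<union> \<beta>"
        if "(x, y) \<in> \<alpha> \<union> \<beta>" for x y
        using that one[OF ab(1) l] one[OF ab(2) l] by auto
      show "(interp A f (us @ x # vs), interp A f (us @ y # vs)) \<in> (\<alpha> \<union> \<beta>)\<^sup>+"
        using xy
      proof (induction rule: trancl_induct)
        case (base y)
        then show ?case by (intro r_into_trancl single)
      next
        case (step y z)
        from step.IH show ?case by (rule trancl_into_trancl) (rule single[OF step.hyps(2)])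
      qed
    qed
  qed
  then show "cong_join ar A \<alpha> \<beta> \<subseteq> (\<alpha> \<union> \<beta>)\<^sup>+"
    by (intro cong_join_least) auto
  have "trans (cong_join ar A \<alpha> \<beta>)"
    by (rule transI) (erule (1) congruence_trans[OF cong_join_congruence[OF A ab]])
  moreover have "(\<alpha> \<union> \<beta>)\<^sup>+ \<subseteq> (cong_join ar A \<alpha> \<beta>)\<^sup>+"
    by (intro trancl_mono_subset Un_least cong_join_upper)
  ultimately show "(\<alpha> \<union> \<beta>)\<^sup>+ \<subseteq> cong_join ar A \<alpha> \<beta>"
    by (simp add: trancl_id)
qed

lemma congruence_pullback:
  assumes A: "ualgebra ar A" and h: "surj_hom ar A B h" and \<theta>: "\<theta> \<in> congruences ar B"
  shows "{(x, y) \<in> carrier A \<times> carrier A. (h x, h y) \<in> \<theta>} \<in> congruences ar A"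
    (is "?\<theta> \<in> _")
proof (rule congruenceI)
  have hc: "h x \<in> carrier B" if "x \<in> carrier A" for x using h that by (auto simp: surj_hom_def)
  show "(x, x) \<in> ?\<theta>" if "x \<in> carrier A" for x
    using that congruence_refl[OF \<theta>] hc by auto
  fix f xs ys
  assume l: "length xs = ar f" and r: "list_all2 (\<lambda>x y. (x, y) \<in> ?\<theta>) xs ys"
  have "set xs \<subseteq> carrier A" "set ys \<subseteq> carrier A" "length ys = ar f"
    using list_all2_carrier[OF r, of "carrier A"] list_all2_lengthD[OF r] l by auto
  moreover have "list_all2 (\<lambda>x y. (x, y) \<in> \<theta>) (map h xs) (map h ys)"
    using r by (auto simp: list_all2_conv_all_nth)
  ultimately show "(interp A f xs, interp A f ys) \<in> ?\<theta>" 
    using congruence_compat[OF \<theta>, of "map h xs" f "map h ys"] l h interp_closed[OF A, of _ f]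
    by (simp add: surj_hom_def)
next
  show "(y, x) \<in> ?\<theta>" if "(x, y) \<in> ?\<theta>" for x y
    using that congruence_sym[OF \<theta>] by simp
  show "(x, z) \<in> ?\<theta>" if "(x, y) \<in> ?\<theta>" "(y, z) \<in> ?\<theta>" for x y z
    using that congruence_trans[OF \<theta>, of "h x" "h y" "h z"] by simp
qed auto

section \<open>The lattice of congruences and its modularity\<close>

lemma Con_simps [simp]:
  "carrier (Con ar A) = congruences ar A" "le (Con ar A) = (\<subseteq>)" "eq (Con ar A) = (=)"
  by (simp_all add: Con_def)

lemma Con_Inf:
  assumes A: "ualgebra ar A" and S: "S \<subseteq> congruences ar A"
  shows "\<Sqinter>\<^bsub>Con ar A\<^esub>S = (carrier A \<times> carrier A) \<inter> \<Inter>S"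
proof -
  have "(carrier A \<times> carrier A) \<inter> \<Inter>S = \<Inter>(insert (carrier A \<times> carrier A) S)" by simp
  also have "\<dots> \<in> congruences ar A"
    using S full_congruence[OF A] by (intro Inter_congruence) auto
  finally have "greatest (Con ar A) ((carrier A \<times> carrier A) \<inter> \<Inter>S) (Lower (Con ar A) S)"
    using S by (simp add: greatest_def Lower_def le_Inf_iff congruence_subset subset_iff_psubset_eq[of S])
      (blast dest: congruence_subset)
  moreover from this have "x = (carrier A \<times> carrier A) \<inter> \<Inter>S"
    if "greatest (Con ar A) x (Lower (Con ar A) S)" for x
    using that by (intro subset_antisym) (simp_all add: greatest_def)
  ultimately show ?thesis unfolding inf_def by (rule some_equality)
qed

lemma Con_meet:
  assumes "ualgebra ar A" "\<alpha> \<in> congruences ar A" "\<beta> \<in> congruences ar A"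
  shows "\<alpha> \<sqinter>\<^bsub>Con ar A\<^esub> \<beta> = \<alpha> \<inter> \<beta>"
  using Con_Inf[OF assms(1), of "{\<alpha>, \<beta>}"] assms congruence_subset[OF assms(2)]
  by (auto simp: meet_def)

lemma Con_join:
  assumes A: "ualgebra ar A" and ab: "\<alpha> \<in> congruences ar A" "\<beta> \<in> congruences ar A"
  shows "\<alpha> \<squnion>\<^bsub>Con ar A\<^esub> \<beta> = cong_join ar A \<alpha> \<beta>"
proof -
  have l: "least (Con ar A) (cong_join ar A \<alpha> \<beta>) (Upper (Con ar A) {\<alpha>, \<beta>})"
    using ab cong_join_congruence[OF A ab] cong_join_least[of _ ar A \<alpha> \<beta>]
    by (auto simp: least_def Upper_def cong_join_upper)
  have "x = cong_join ar A \<alpha> \<beta>" if "least (Con ar A) x (Upper (Con ar A) {\<alpha>, \<beta>})" for x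
    using that l by (intro subset_antisym) (simp_all add: least_def)
  with l show ?thesis unfolding join_def sup_def by (rule some_equality)
qed

lemma eval_trm_closed:
  assumes A: "ualgebra ar A" and \<rho>: "range \<rho> \<subseteq> carrier A"
  shows "wf_trm ar t \<Longrightarrow> eval_trm A \<rho> t \<in> carrier A"
proof (induction t)
  case (Var i)
  then show ?case using \<rho> by auto
next
  case (Fun f ts)
  then show ?case by (auto intro!: interp_closed[OF A])
qed

lemma eval_trm_hom:
  assumes A: "ualgebra ar A" and h: "surj_hom ar A B h" and \<rho>: "range \<rho> \<subseteq> carrier A"
  shows "wf_trm ar t \<Longrightarrow> eval_trm B (h \<circ> \<rho>) t = h (eval_trm A \<rho> t)"
proof (induction t)
  case (Fun f ts)
  have eq: "map (eval_trm B (h \<circ> \<rho>)) ts = map h (map (eval_trm A \<rho>) ts)"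
    using Fun.IH Fun.prems by (simp del: comp_apply) simp
  have "set (map (eval_trm A \<rho>) ts) \<subseteq> carrier A" "length (map (eval_trm A \<rho>) ts) = ar f"
    using Fun.prems eval_trm_closed[OF A \<rho>] by auto
  then have "h (interp A f (map (eval_trm A \<rho>) ts)) = interp B f (map h (map (eval_trm A \<rho>) ts))"
    using h unfolding surj_hom_def by blast
  then show ?case unfolding eval_trm.simps eq by simp
qed simp

lemma lift_valuation:
  fixes \<rho> :: "nat \<Rightarrow> 'b"
  assumes h: "surj_hom ar A B h" and \<rho>: "range \<rho> \<subseteq> carrier B"
  obtains \<sigma> where "range \<sigma> \<subseteq> carrier A" "\<rho> = h \<circ> \<sigma>"
proof
  have "h ` carrier A = carrier B" using h by (simp add: surj_hom_def)
  with \<rho> have "\<rho> i \<in> h ` carrier A" for i by auto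
  then have *: "inv_into (carrier A) h (\<rho> i) \<in> carrier A" "h (inv_into (carrier A) h (\<rho> i)) = \<rho> i" for i
    by (simp_all add: inv_into_into f_inv_into_f)
  show "range (\<lambda>i. inv_into (carrier A) h (\<rho> i)) \<subseteq> carrier A" using *(1) by auto
  show "\<rho> = h \<circ> (\<lambda>i. inv_into (carrier A) h (\<rho> i))" using *(2) by auto
qed

lemma in_generated_variety_hom_image:
  assumes T: "in_generated_variety ar A T" and h: "surj_hom ar T B h" and B: "ualgebra ar B"
  shows "in_generated_variety ar A B"
  unfolding in_generated_variety_def
proof (intro conjI allI impI B)
  fix s t
  assume st: "wf_trm ar s \<and> wf_trm ar t \<and> satisfies A s t"
  have uT: "ualgebra ar T" and sat: "satisfies T s t"
    using T st by (auto simp: in_generated_variety_def)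
  show "satisfies B s t"
    unfolding satisfies_def
  proof (intro allI impI)
    fix \<rho> :: "nat \<Rightarrow> _" assume "range \<rho> \<subseteq> carrier B"
    then obtain \<sigma> where r: "range \<sigma> \<subseteq> carrier T" and \<rho>: "\<rho> = h \<circ> \<sigma>"
      by (rule lift_valuation[OF h])
    have "eval_trm T \<sigma> s = eval_trm T \<sigma> t" using sat r by (simp add: satisfies_def)
    then show "eval_trm B \<rho> s = eval_trm B \<rho> t"
      unfolding \<rho> using st eval_trm_hom[OF uT h r] by simp
  qed
qed

text \<open>
  A function whose kernel is a congruence transports the operations to its image. This gives both
  isomorphic copies and quotients.
\<close>

definition hom_image :: "('f, 'a) ualg \<Rightarrow> ('a \<Rightarrow> 'b) \<Rightarrow> ('f, 'b) ualg" where
  "hom_image A h = \<lparr>carrier = h ` carrier A,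
     interp = \<lambda>f xs. h (interp A f (map (inv_into (carrier A) h) xs))\<rparr>"

lemma hom_image:
  assumes A: "ualgebra ar A"
    and ker: "{(x, y) \<in> carrier A \<times> carrier A. h x = h y} \<in> congruences ar A" (is "?\<theta> \<in> _")
  shows "ualgebra ar (hom_image A h)" and "surj_hom ar A (hom_image A h) h"
proof -
  have inv: "set (map (inv_into (carrier A) h) ys) \<subseteq> carrier A" if "set ys \<subseteq> h ` carrier A" for ys
    using that by (auto intro: inv_into_into)
  show "ualgebra ar (hom_image A h)"
    using A inv interp_closed[OF A] by (auto simp: ualgebra_def hom_image_def)
  have "h (interp A f xs) = h (interp A f (map (inv_into (carrier A) h) (map h xs)))"
    if l: "length xs = ar f" and c: "set xs \<subseteq> carrier A" for f xs
  proof -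
    have "list_all2 (\<lambda>x y. (x, y) \<in> ?\<theta>) xs (map (inv_into (carrier A) h) (map h xs))"
      using c by (induction xs) (auto simp: f_inv_into_f inv_into_into)
    from congruence_compat[OF ker l this] show ?thesis by simp
  qed
  then show "surj_hom ar A (hom_image A h) h"
    by (auto simp: surj_hom_def hom_image_def)
qed

text \<open>
  Modularity is assumed for the members of the variety whose carrier consists of natural numbers.
  It passes to all finite members, as these have copies of that kind.
\<close>

lemma modular_law:
  fixes A :: "('f, 'a) ualg" and T :: "('f, 'b) ualg"
  assumes mod: "generates_congruence_modular ar A" and T: "in_generated_variety ar A T"
    and fin: "finite (carrier T)"
    and con: "\<alpha> \<in> congruences ar T" "\<beta> \<in> congruences ar T" "\<gamma> \<in> congruences ar T"
    and le: "\<alpha> \<subseteq> \<gamma>"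
  shows "cong_join ar T \<alpha> \<beta> \<inter> \<gamma> \<subseteq> cong_join ar T \<alpha> (\<beta> \<inter> \<gamma>)"
proof -
  have uT: "ualgebra ar T" using T by (simp add: in_generated_variety_def)
  obtain h :: "'b \<Rightarrow> nat" where inj: "inj_on h (carrier T)"
    using finite_imp_inj_to_nat_seg[OF fin] by blast
  define g where "g = inv_into (carrier T) h"
  define B where "B = hom_image T h"
  have cB: "carrier B = h ` carrier T" by (simp add: B_def hom_image_def)
  have gh: "g (h x) = x" if "x \<in> carrier T" for x
    unfolding g_def using inj that by (rule inv_into_f_f)
  have "{(x, y) \<in> carrier T \<times> carrier T. h x = h y} = Id_on (carrier T)"
    using inj by (auto simp: inj_on_def)
  then have h: "surj_hom ar T B h" and uB: "ualgebra ar B"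
    using hom_image[OF uT, of h] identity_congruence[OF uT] by (simp_all add: B_def)
  have "g (interp B f xs) = interp T f (map g xs)"
    if "length xs = ar f" "set xs \<subseteq> carrier B" for f xs
  proof -
    have "set (map g xs) \<subseteq> carrier T" using that(2) by (auto simp: cB gh)
    then show ?thesis
      using that(1) interp_closed[OF uT, of "map g xs" f] by (simp add: B_def hom_image_def g_def[symmetric] gh)
  qed
  then have g: "surj_hom ar B T g"
    by (auto simp: surj_hom_def cB gh image_image)
  define push where "push = (\<lambda>\<theta>. {(x, y) \<in> carrier B \<times> carrier B. (g x, g y) \<in> \<theta>})"
  define pull where "pull = (\<lambda>\<theta>. {(x, y) \<in> carrier T \<times> carrier T. (h x, h y) \<in> \<theta>})"
  have push: "push \<theta> \<in> congruences ar B" if "\<theta> \<in> congruences ar T" for \<theta>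
    unfolding push_def by (rule congruence_pullback[OF uB g that])
  have pull: "pull \<theta> \<in> congruences ar T" if "\<theta> \<in> congruences ar B" for \<theta>
    unfolding pull_def by (rule congruence_pullback[OF uT h that])
  have mem_push: "(h x, h y) \<in> push \<theta> \<longleftrightarrow> (x, y) \<in> \<theta>"
    if "x \<in> carrier T" "y \<in> carrier T" for x y \<theta>
    using that by (simp add: push_def cB gh)
  have push_mono: "push \<theta> \<subseteq> push \<theta>'" if "\<theta> \<subseteq> \<theta>'" for \<theta> \<theta>'
    using that by (auto simp: push_def)
  have push_Int: "push (\<theta> \<inter> \<theta>') = push \<theta> \<inter> push \<theta>'" for \<theta> \<theta>'
    by (auto simp: push_def)
  have le_pull: "\<theta> \<subseteq> pull \<theta>'" if "push \<theta> \<subseteq> \<theta>'" "\<theta> \<in> congruences ar T" for \<theta> \<theta>'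
  proof (rule subrelI)
    fix x y assume "(x, y) \<in> \<theta>"
    then show "(x, y) \<in> pull \<theta>'"
      using that(1) mem_push[of x y \<theta>] congruence_carrier[OF that(2), of x y] by (auto simp: pull_def)
  qed
  have "modular_lattice (Con ar B)"
    using mod in_generated_variety_hom_image[OF T h uB] by (simp add: generates_congruence_modular_def)
  then have *: "cong_join ar B (push \<alpha>) (push \<beta>) \<inter> push \<gamma> = cong_join ar B (push \<alpha>) (push \<beta> \<inter> push \<gamma>)"
    using modular_lattice.modular[of "Con ar B" "push \<alpha>" "push \<beta>" "push \<gamma>"] push[OF con(1)]
      push[OF con(2)] push[OF con(3)] le
    by (simp add: Con_meet[OF uB] Con_join[OF uB] cong_join_congruence[OF uB] Int_congruence push_mono)
  show ?thesis
  proof (rule subrelI)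
    fix x y assume xy: "(x, y) \<in> cong_join ar T \<alpha> \<beta> \<inter> \<gamma>"
    then have c: "x \<in> carrier T" "y \<in> carrier T"
      using congruence_carrier[OF con(3)] by auto
    have "cong_join ar T \<alpha> \<beta> \<subseteq> pull (cong_join ar B (push \<alpha>) (push \<beta>))"
      by (intro cong_join_least pull cong_join_congruence uB le_pull cong_join_upper push con)
    with xy c have "(h x, h y) \<in> cong_join ar B (push \<alpha>) (push \<beta>) \<inter> push \<gamma>"
      by (auto simp: pull_def mem_push)
    then have xy': "(h x, h y) \<in> cong_join ar B (push \<alpha>) (push \<beta> \<inter> push \<gamma>)"
      by (simp add: *)
    have "cong_join ar B (push \<alpha>) (push \<beta> \<inter> push \<gamma>) \<subseteq> push (cong_join ar T \<alpha> (\<beta> \<inter> \<gamma>))"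
    proof (rule cong_join_least)
      show "push (cong_join ar T \<alpha> (\<beta> \<inter> \<gamma>)) \<in> congruences ar B"
        by (intro push cong_join_congruence uT Int_congruence con)
      show "push \<alpha> \<subseteq> push (cong_join ar T \<alpha> (\<beta> \<inter> \<gamma>))"
        by (rule push_mono[OF cong_join_upper(1)])
      show "push \<beta> \<inter> push \<gamma> \<subseteq> push (cong_join ar T \<alpha> (\<beta> \<inter> \<gamma>))"
        unfolding push_Int[symmetric] by (rule push_mono[OF cong_join_upper(2)])
    qed
    from subsetD[OF this xy'] show "(x, y) \<in> cong_join ar T \<alpha> (\<beta> \<inter> \<gamma>)"
      by (rule mem_push[OF c, THEN iffD1])
  qed
qed

section \<open>A consequence of modularity for subalgebras of powers\<close>

definition subpower :: "('f, 'a) ualg \<Rightarrow> ('i \<Rightarrow> 'a) set \<Rightarrow> ('f, 'i \<Rightarrow> 'a) ualg" where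
  "subpower A S = \<lparr>carrier = S, interp = \<lambda>f gs i. interp A f (map (\<lambda>g. g i) gs)\<rparr>"

lemma subpower_simps [simp]:
  "carrier (subpower A S) = S" "interp (subpower A S) f gs i = interp A f (map (\<lambda>g. g i) gs)"
  by (simp_all add: subpower_def)

lemma eval_trm_subpower:
  "eval_trm (subpower A S) \<rho> t i = eval_trm A (\<lambda>n. \<rho> n i) t"
proof (induction t)
  case (Fun f ts)
  have "map (\<lambda>t. eval_trm (subpower A S) \<rho> t i) ts = map (eval_trm A (\<lambda>n. \<rho> n i)) ts"
    by (rule map_cong[OF refl]) (rule Fun.IH)
  then show ?case by (simp only: eval_trm.simps subpower_simps map_map o_def)
qed simp

lemma subpower_in_generated_variety:
  assumes S: "ualgebra ar (subpower A S)" and sub: "\<And>g i. g \<in> S \<Longrightarrow> g i \<in> carrier A"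
  shows "in_generated_variety ar A (subpower A S)"
  unfolding in_generated_variety_def
proof (intro conjI allI impI S)
  fix s t
  assume "wf_trm ar s \<and> wf_trm ar t \<and> satisfies A s t"
  then have sat: "satisfies A s t" by simp
  show "satisfies (subpower A S) s t"
    unfolding satisfies_def
  proof (intro allI impI ext)
    fix \<rho> :: "nat \<Rightarrow> _" and i assume "range \<rho> \<subseteq> carrier (subpower A S)"
    then have "range (\<lambda>n. \<rho> n i) \<subseteq> carrier A" using sub by auto
    with sat show "eval_trm (subpower A S) \<rho> s i = eval_trm (subpower A S) \<rho> t i"
      unfolding eval_trm_subpower satisfies_def by blast
  qed
qed

lemma subpower_coordinatewise_congruence:
  assumes S: "ualgebra ar (subpower A S)" and sub: "\<And>g i. g \<in> S \<Longrightarrow> g i \<in> carrier A"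
    and \<theta>: "\<And>i. i \<in> I \<Longrightarrow> \<theta> i \<in> congruences ar A"
  shows "{(g, h) \<in> S \<times> S. \<forall>i\<in>I. (g i, h i) \<in> \<theta> i} \<in> congruences ar (subpower A S)"
    (is "?\<Theta> \<in> _")
proof (rule congruenceI)
  show "(g, g) \<in> ?\<Theta>" if "g \<in> carrier (subpower A S)" for g
    using that sub congruence_refl[OF \<theta>] by auto
  show "(h, g) \<in> ?\<Theta>" if "(g, h) \<in> ?\<Theta>" for g h
    using that congruence_sym[OF \<theta>] by auto
  show "(g, k) \<in> ?\<Theta>" if "(g, h) \<in> ?\<Theta>" "(h, k) \<in> ?\<Theta>" for g h k
    using that congruence_trans[OF \<theta>, of _ "g _" "h _" "k _"] by blast
  fix f gs hs
  assume l: "length gs = ar f" and r: "list_all2 (\<lambda>g h. (g, h) \<in> ?\<Theta>) gs hs"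
  have "(interp A f (map (\<lambda>g. g i) gs), interp A f (map (\<lambda>g. g i) hs)) \<in> \<theta> i" if i: "i \<in> I" for i
  proof (rule congruence_compat[OF \<theta>[OF i]])
    show "list_all2 (\<lambda>x y. (x, y) \<in> \<theta> i) (map (\<lambda>g. g i) gs) (map (\<lambda>g. g i) hs)"
      using r i by (auto simp: list_all2_map1 list_all2_map2 elim!: list_all2_mono)
  qed (simp add: l)
  moreover have "set gs \<subseteq> S" "set hs \<subseteq> S"
    by (rule list_all2_carrier[OF r]; auto)+
  ultimately show "(interp (subpower A S) f gs, interp (subpower A S) f hs) \<in> ?\<Theta>"
    using l list_all2_lengthD[OF r] interp_closed[OF S, of _ f] by auto
qed auto

text \<open>The positions in the tuples \<open>(p, e', q, r, s)\<close> of \<open>modular_corner\<close>.\<close>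

datatype coord = CP | CE | CQ | CR | CS

lemma finite_coord_functions:
  assumes "finite C"
  shows "finite {g :: coord \<Rightarrow> 'a. \<forall>i. g i \<in> C}"
proof -
  have "(UNIV :: coord set) = {CP, CE, CQ, CR, CS}" by (auto intro: coord.exhaust)
  then have "finite (UNIV :: coord set)" by (metis finite.emptyI finite.insertI)
  then have "finite (PiE (UNIV :: coord set) (\<lambda>_. C))" using assms by (intro finite_PiE) auto
  also have "PiE (UNIV :: coord set) (\<lambda>_. C) = {g. \<forall>i. g i \<in> C}" by auto
  finally show ?thesis .
qed

text \<open>
  If the congruences \<open>\<beta>\<close> and \<open>\<phi>\<close> permuted, the path \<open>b \<phi> e \<beta> a\<close> could be completed to a parallelogram
  with a fourth corner \<open>c\<close>, so that \<open>b \<beta> c \<phi> a\<close>. The assumptions on \<open>\<psi>\<close> give the pair \<open>(e, a)\<close> the properties of a pair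
  in an abelian congruence, and in a congruence modular variety this is enough, except that \<open>a\<close> may have to be replaced by
  another element \<open>s\<close> of the \<open>\<beta>\<close>-class of \<open>e\<close> that is outside its \<open>\<phi>\<close>-class.

  The subalgebra \<open>S\<close> below consists of tuples \<open>(p, e', q, r, s)\<close>. The pair \<open>(p, s)\<close> records that there is a corner
  for \<open>p\<close> and \<open>s\<close>. The other four entries are congruent modulo \<open>\<beta>\<close>, and \<open>\<Gamma>\<close> links them so that
  \<open>q \<phi> e'\<close> iff \<open>r \<phi> s\<close>, as if \<open>q - e' = r - s\<close> in an abelian group. The tuples with
  \<open>(p, e') = (b, e)\<close> are the ones of interest, and two of them, \<open>x\<close> and \<open>u\<close>, have
  \<open>(q, r) = (e, e)\<close> and \<open>(q, r) = (a, a)\<close>. By the modular law they are joined by a path that keeps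
  \<open>(p, e')\<close> fixed and changes only one of \<open>q\<close> and \<open>r\<close> at a time (besides \<open>s\<close>). On this path \<open>q\<close>
  leaves the \<open>\<phi>\<close>-class of \<open>e\<close> at some step. At that step \<open>r\<close> is constant, so \<open>s\<close> changes its \<open>\<phi>\<close>-class, and one of the
  two values of \<open>s\<close> lies outside the class of \<open>e\<close>.
\<close>

lemma modular_corner:
  fixes A :: "('f, 'a) ualg"
  assumes mod: "generates_congruence_modular ar A" and A: "ualgebra ar A" and fin: "finite (carrier A)"
    and con: "\<phi> \<in> congruences ar A" "\<psi> \<in> congruences ar A" "\<beta> \<in> congruences ar A"
    and eq: "\<beta> \<inter> \<phi> = \<beta> \<inter> \<psi>" and eb: "(e, b) \<in> \<phi>"
    and ea: "(e, a) \<in> \<beta>" "(e, a) \<in> cong_join ar A \<phi> \<psi>" "(e, a) \<notin> \<phi>"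
  obtains c s where "(b, c) \<in> \<beta>" "(c, s) \<in> \<phi>" "(e, s) \<in> \<beta>" "(e, s) \<notin> \<phi>"
proof (rule ccontr)
  assume "\<not> thesis"
  with that have no_corner: False if "(b, s) \<in> \<beta> O \<phi>" "(e, s) \<in> \<beta>" "(e, s) \<notin> \<phi>" for s
    using that by blast
  have e: "e \<in> carrier A" and b: "b \<in> carrier A" and a: "a \<in> carrier A"
    using congruence_carrier[OF con(1) eb] congruence_carrier[OF con(3) ea(1)] by auto
  \<comment> \<open>The congruence \<open>\<beta>\<close> as a subalgebra of the square of \<open>A\<close>, a pair being a function on \<open>bool\<close>.\<close>
  define pair :: "'a \<Rightarrow> 'a \<Rightarrow> bool \<Rightarrow> 'a" where "pair = (\<lambda>x y i. if i then y else x)"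
  have pair_simps [simp]: "pair x y False = x" "pair x y True = y" for x y
    by (simp_all add: pair_def)
  have pair_interp: "interp (subpower A E) f (map (\<lambda>g. pair (p g) (q g)) gs) =
      pair (interp A f (map p gs)) (interp A f (map q gs))"
    for E f gs and p q :: "'x \<Rightarrow> 'a"
    by (rule ext) (simp add: pair_def o_def)
  define D where "D = {g :: bool \<Rightarrow> 'a. (g False, g True) \<in> \<beta>}"
  have D_carrier: "g i \<in> carrier A" if "g \<in> D" for g i
    using congruence_carrier[OF con(3), of "g False" "g True"] that by (cases i) (auto simp: D_def)
  have B: "ualgebra ar (subpower A D)"
    unfolding ualgebra_def
  proof (intro conjI allI impI)
    show "carrier (subpower A D) \<noteq> {}"
      using congruence_refl[OF con(3) e] by (auto simp: D_def intro: exI[of _ "\<lambda>_. e"])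
    fix f gs assume gs: "length gs = ar f \<and> set gs \<subseteq> carrier (subpower A D)"
    then have "list_all2 (\<lambda>x y. (x, y) \<in> \<beta>) (map (\<lambda>g. g False) gs) (map (\<lambda>g. g True) gs)"
      by (auto simp: list_all2_map1 list_all2_map2 D_def intro!: list.rel_refl_strong)
    with gs show "interp (subpower A D) f gs \<in> carrier (subpower A D)"
      using congruence_compat[OF con(3)] by (simp add: D_def)
  qed
  define \<Phi> where "\<Phi> = (\<lambda>\<theta>. {(g, h) \<in> D \<times> D. \<forall>i\<in>UNIV. (g i, h i) \<in> \<theta>})"
  have \<Phi>: "\<Phi> \<theta> \<in> congruences ar (subpower A D)" if "\<theta> \<in> congruences ar A" for \<theta>
    unfolding \<Phi>_def using that by (intro subpower_coordinatewise_congruence B D_carrier)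
  \<comment> \<open>Both joinands preserve membership of a pair in \<open>\<beta> \<inter> \<phi> = \<beta> \<inter> \<psi>\<close>, so the join does. On the other
    hand it moves \<open>(e, e)\<close> to \<open>(a, a)\<close>.\<close>
  define \<Gamma> where "\<Gamma> = cong_join ar (subpower A D) (\<Phi> \<phi>) (\<Phi> \<psi>)"
  have \<Gamma>: "\<Gamma> \<in> congruences ar (subpower A D)"
    unfolding \<Gamma>_def by (intro cong_join_congruence B \<Phi> con)
  have \<Gamma>_trancl: "\<Gamma> = (\<Phi> \<phi> \<union> \<Phi> \<psi>)\<^sup>+"
    unfolding \<Gamma>_def by (intro cong_join_trancl B \<Phi> con)
  have diag: "(pair x x, pair y y) \<in> \<Gamma>" if "(x, y) \<in> cong_join ar A \<phi> \<psi>" for x y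
  proof -
    have "(pair x x, pair y y) \<in> \<Phi> \<theta>" if "(x, y) \<in> \<theta>" "\<theta> \<in> congruences ar A" for x y \<theta>
      using that congruence_carrier[OF that(2,1)] congruence_refl[OF con(3)]
      by (auto simp: \<Phi>_def D_def pair_def)
    then have single: "(pair x x, pair y y) \<in> \<Gamma>" if "(x, y) \<in> \<phi> \<union> \<psi>" for x y
      using that con unfolding \<Gamma>_trancl by (intro r_into_trancl) blast
    have "(x, y) \<in> (\<phi> \<union> \<psi>)\<^sup>+" using that unfolding cong_join_trancl[OF A con(1,2)] .
    then show ?thesis
      by (induction rule: trancl_induct) (auto intro: single congruence_trans[OF \<Gamma>])
  qed
  have saturated: "(g False, g True) \<in> \<phi> \<longleftrightarrow> (h False, h True) \<in> \<phi>" if "(g, h) \<in> \<Gamma>" for g h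
  proof -
    have transfer: "(g False, g True) \<in> \<theta> \<longleftrightarrow> (h False, h True) \<in> \<theta>"
      if "(g, h) \<in> \<Phi> \<theta>" "\<theta> \<in> congruences ar A" for g h \<theta>
    proof -
      have "(g i, h i) \<in> \<theta>" for i using that(1) by (simp add: \<Phi>_def)
      then show ?thesis
        using congruence_trans[OF that(2)] congruence_sym[OF that(2)] by metis
    qed
    have D: "(g False, g True) \<in> \<phi> \<longleftrightarrow> (g False, g True) \<in> \<psi>" if "g \<in> D" for g
      using that eq by (auto simp: D_def)
    have single: "(g False, g True) \<in> \<phi> \<longleftrightarrow> (h False, h True) \<in> \<phi>" if "(g, h) \<in> \<Phi> \<phi> \<union> \<Phi> \<psi>" for g h
      using that
    proof
      assume "(g, h) \<in> \<Phi> \<psi>"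
      moreover from this have "g \<in> D" "h \<in> D" by (simp_all add: \<Phi>_def)
      ultimately show ?thesis using transfer[OF _ con(2)] D by simp
    qed (rule transfer[OF _ con(1)])
    from that show ?thesis unfolding \<Gamma>_trancl
      by (induction rule: trancl_induct) (use single in simp_all)
  qed
  define S where "S = {g :: coord \<Rightarrow> 'a. (\<forall>i. g i \<in> carrier A) \<and>
      (g CQ, g CE) \<in> \<beta> \<and> (g CR, g CE) \<in> \<beta> \<and> (g CS, g CE) \<in> \<beta> \<and>
      (pair (g CQ) (g CE), pair (g CR) (g CS)) \<in> \<Gamma> \<and> (g CP, g CS) \<in> \<beta> O \<phi>}"
  have S_carrier: "g i \<in> carrier A" if "g \<in> S" for g i
    using that by (simp add: S_def)
  define mk :: "'a \<Rightarrow> 'a \<Rightarrow> 'a \<Rightarrow> 'a \<Rightarrow> 'a \<Rightarrow> coord \<Rightarrow> 'a" where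
    "mk = (\<lambda>p e q r s i. case i of CP \<Rightarrow> p | CE \<Rightarrow> e | CQ \<Rightarrow> q | CR \<Rightarrow> r | CS \<Rightarrow> s)"
  have mk_simps [simp]: "mk p e q r s CP = p" "mk p e q r s CE = e" "mk p e q r s CQ = q"
    "mk p e q r s CR = r" "mk p e q r s CS = s" for p e q r s
    by (simp_all add: mk_def)
  have mk_S: "mk p e q r s \<in> S"
    if "{p, q, r, s} \<subseteq> carrier A" "(q, e) \<in> \<beta>" "(r, e) \<in> \<beta>" "(s, e) \<in> \<beta>"
      "(pair q e, pair r s) \<in> \<Gamma>" "(p, s) \<in> \<beta> O \<phi>" for p q r s
  proof -
    have "mk p e q r s i \<in> carrier A" for i using that(1) e by (cases i) auto
    then show ?thesis using that by (simp add: S_def)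
  qed
  have refl: "(x, x) \<in> \<theta>" if "x \<in> carrier A" "\<theta> \<in> congruences ar A" for x \<theta>
    using that congruence_refl by metis
  have \<Gamma>_refl: "(pair x y, pair x y) \<in> \<Gamma>" if "(x, y) \<in> \<beta>" for x y
    using that by (intro congruence_refl[OF \<Gamma>]) (simp add: D_def)
  have \<beta>_a: "(a, e) \<in> \<beta>" using ea(1) by (rule congruence_sym[OF con(3)])
  have be: "(b, e) \<in> \<phi>" using eb by (rule congruence_sym[OF con(1)])
  \<comment> \<open>The elements \<open>y\<close> and \<open>z\<close> differ from \<open>x\<close> and \<open>u\<close> in the entry \<open>p\<close>. They connect \<open>x\<close> with \<open>u\<close> by
    steps that fix \<open>r\<close>, fix \<open>(p, e', q)\<close>, and fix \<open>r\<close> again.\<close>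
  define x y z u where "x = mk b e e e e" and "y = mk e e e e e" and "z = mk e e e a a"
    and "u = mk b e a a e"
  have xS: "x \<in> S" and yS: "y \<in> S" and zS: "z \<in> S" and uS: "u \<in> S"
  proof -
    have "(b, e) \<in> \<beta> O \<phi>" "(e, e) \<in> \<beta> O \<phi>" "(e, a) \<in> \<beta> O \<phi>"
      using refl[OF b con(3)] be refl[OF e con(3)] refl[OF e con(1)] ea(1) refl[OF a con(1)]
      by (blast intro: relcompI)+
    moreover have "(e, e) \<in> \<beta>" "(a, e) \<in> \<beta>" by (rule refl[OF e con(3)], rule \<beta>_a)
    moreover have "(pair e e, pair e e) \<in> \<Gamma>" "(pair e e, pair a a) \<in> \<Gamma>" "(pair a e, pair a e) \<in> \<Gamma>"
      using diag[OF ea(2)] \<Gamma>_refl refl[OF e con(3)] \<beta>_a by auto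
    ultimately show "x \<in> S" "y \<in> S" "z \<in> S" "u \<in> S"
      unfolding x_def y_def z_def u_def using e b a by (simp_all add: mk_S)
  qed
  have T: "ualgebra ar (subpower A S)"
    unfolding ualgebra_def
  proof (intro conjI allI impI)
    show "carrier (subpower A S) \<noteq> {}" using xS by auto
    fix f gs assume gs: "length gs = ar f \<and> set gs \<subseteq> carrier (subpower A S)"
    have mem: "g \<in> S" if "g \<in> set gs" for g using gs that by auto
    have rel: "(interp A f (map p gs), interp A f (map q gs)) \<in> \<theta>"
      if "\<And>g. g \<in> S \<Longrightarrow> (p g, q g) \<in> \<theta>" "\<theta> \<in> congruences ar A" for p q \<theta>
    proof (rule congruence_compat[OF that(2)])
      show "list_all2 (\<lambda>x y. (x, y) \<in> \<theta>) (map p gs) (map q gs)"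
        using that(1) mem by (auto simp: list_all2_map1 list_all2_map2 intro!: list.rel_refl_strong)
    qed (use gs in simp)
    let ?g = "interp (subpower A S) f gs"
    have "\<exists>c. (g CP, c) \<in> \<beta> \<and> (c, g CS) \<in> \<phi>" if "g \<in> S" for g
      using that by (auto simp: S_def)
    then obtain c where c: "\<And>g. g \<in> S \<Longrightarrow> (g CP, c g) \<in> \<beta> \<and> (c g, g CS) \<in> \<phi>" by metis
    have "(?g CP, ?g CS) \<in> \<beta> O \<phi>"
      unfolding subpower_simps by (rule relcompI[OF rel[OF _ con(3)] rel[OF _ con(1)]]) (use c in auto)
    moreover have "(pair (?g CQ) (?g CE), pair (?g CR) (?g CS)) \<in> \<Gamma>"
      unfolding subpower_simps unfolding pair_interp[of D, symmetric]
    proof (rule congruence_compat[OF \<Gamma>])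
      show "list_all2 (\<lambda>x y. (x, y) \<in> \<Gamma>) (map (\<lambda>g. pair (g CQ) (g CE)) gs) (map (\<lambda>g. pair (g CR) (g CS)) gs)"
        using mem by (auto simp: S_def list_all2_map1 list_all2_map2 intro!: list.rel_refl_strong)
    qed (use gs in simp)
    moreover have "(?g CQ, ?g CE) \<in> \<beta>" "(?g CR, ?g CE) \<in> \<beta>" "(?g CS, ?g CE) \<in> \<beta>"
      unfolding subpower_simps by (rule rel[OF _ con(3)]; simp add: S_def)+
    moreover have "?g i \<in> carrier A" for i
      unfolding subpower_simps using gs mem S_carrier by (intro interp_closed[OF A]) auto
    ultimately show "interp (subpower A S) f gs \<in> carrier (subpower A S)"
      by (simp add: S_def del: subpower_simps(2))
  qed
  have finS: "finite (carrier (subpower A S))"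
    by (rule finite_subset[OF _ finite_coord_functions[OF fin]]) (auto simp: S_def)
  define ker where "ker = (\<lambda>I. {(g, h) \<in> S \<times> S. \<forall>i\<in>I. (g i, h i) \<in> Id_on (carrier A)})"
  have ker: "ker I \<in> congruences ar (subpower A S)" for I
    unfolding ker_def by (intro subpower_coordinatewise_congruence T S_carrier identity_congruence A)
  have mem_ker: "(g, h) \<in> ker I \<longleftrightarrow> (\<forall>i\<in>I. g i = h i)" if "g \<in> S" "h \<in> S" for g h I
    using that S_carrier by (auto simp: ker_def)
  let ?J = "cong_join ar (subpower A S)"
  let ?P = "ker {CP, CE}" and ?Q = "ker {CP, CE, CQ}" and ?R = "ker {CR}"
  have J: "?J ?Q ?R \<in> congruences ar (subpower A S)"
    by (intro cong_join_congruence T ker)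
  have "(x, y) \<in> ?R" "(y, z) \<in> ?Q" "(z, u) \<in> ?R" "(x, u) \<in> ?P"
    using xS yS zS uS by (simp_all add: mem_ker, simp_all add: x_def y_def z_def u_def)
  then have "(x, u) \<in> ?J ?Q ?R \<inter> ?P"
    using cong_join_upper[of ?Q ar "subpower A S" ?R] cong_join_upper[of ?R ar "subpower A S" ?Q]
      congruence_trans[OF J] by (meson IntI cong_join_upper subsetD)
  \<comment> \<open>The modular law replaces the path through \<open>y\<close> and \<open>z\<close> by one on which \<open>(p, e')\<close> never changes.\<close>
  also have "?J ?Q ?R \<inter> ?P \<subseteq> ?J ?Q (?R \<inter> ?P)"
  proof (rule modular_law[OF mod _ finS ker ker ker])
    show "in_generated_variety ar A (subpower A S)"
      by (rule subpower_in_generated_variety[OF T]) (rule S_carrier)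
    show "?Q \<subseteq> ?P" by (auto simp: ker_def)
  qed
  also have "\<dots> = (?Q \<union> ?R \<inter> ?P)\<^sup>+"
    by (intro cong_join_trancl T ker Int_congruence)
  finally have "(x, u) \<in> (?Q \<union> ?R \<inter> ?P)\<^sup>+" .
  then have "u \<in> S \<and> u CP = b \<and> u CE = e \<and> (u CQ, e) \<in> \<phi>"
  proof (rule trancl_induct)
    have inv: "h \<in> S \<and> h CP = b \<and> h CE = e \<and> (h CQ, e) \<in> \<phi>"
      if g: "g \<in> S \<and> g CP = b \<and> g CE = e \<and> (g CQ, e) \<in> \<phi>" and gh: "(g, h) \<in> ?Q \<union> ?R \<inter> ?P" for g h
    proof -
      have hS: "h \<in> S" using gh by (auto simp: ker_def)
      have h: "h CP = b" "h CE = e" using gh g by (auto simp: ker_def)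
      have "(h CQ, e) \<in> \<phi>"
      proof (cases "g CQ = h CQ")
        case False
        then have R: "g CR = h CR" using gh by (auto simp: ker_def)
        show ?thesis
        proof (rule ccontr)
          assume nh: "(h CQ, e) \<notin> \<phi>"
          have "(g CR, g CS) \<in> \<phi>" "(h CR, h CS) \<notin> \<phi>"
            using saturated[of "pair (g CQ) (g CE)" "pair (g CR) (g CS)"]
              saturated[of "pair (h CQ) (h CE)" "pair (h CR) (h CS)"] g hS h nh by (auto simp: S_def)
          then have "\<not> ((e, g CS) \<in> \<phi> \<and> (e, h CS) \<in> \<phi>)"
            using R congruence_trans[OF con(1)] congruence_sym[OF con(1)] by metis
          moreover have "(e, k CS) \<in> \<phi>" if "k \<in> S" "k CP = b" "k CE = e" for k
            using no_corner[of "k CS"] congruence_sym[OF con(3), of "k CS" e] that by (auto simp: S_def)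
          ultimately show False using g hS h by blast
        qed
      qed (use g in simp)
      with hS h show ?thesis by blast
    qed
    have "x \<in> S \<and> x CP = b \<and> x CE = e \<and> (x CQ, e) \<in> \<phi>"
      using xS refl[OF e con(1)] by (simp add: x_def)
    then show "h \<in> S \<and> h CP = b \<and> h CE = e \<and> (h CQ, e) \<in> \<phi>" if "(x, h) \<in> ?Q \<union> ?R \<inter> ?P" for h
      using inv that by blast
    show "h \<in> S \<and> h CP = b \<and> h CE = e \<and> (h CQ, e) \<in> \<phi>"
      if "g \<in> S \<and> g CP = b \<and> g CE = e \<and> (g CQ, e) \<in> \<phi>" "(g, h) \<in> ?Q \<union> ?R \<inter> ?P" for g h
      using inv that by blast
  qed
  then have "(e, a) \<in> \<phi>" using congruence_sym[OF con(1)] by (simp add: u_def)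
  with ea(3) show False ..
qed

section \<open>Covers and meet irreducibles in a strongly Fregean algebra\<close>

lemma const_val_eq:
  assumes "constant_trm ar A u" "range \<rho> \<subseteq> carrier A"
  shows "const_val A u = eval_trm A \<rho> u"
  unfolding const_val_def
proof (rule the_equality)
  show *: "\<forall>\<sigma>. range \<sigma> \<subseteq> carrier A \<longrightarrow> eval_trm A \<sigma> u = eval_trm A \<rho> u"
    using assms unfolding constant_trm_def by blast
  show "c = eval_trm A \<rho> u" if "\<forall>\<sigma>. range \<sigma> \<subseteq> carrier A \<longrightarrow> eval_trm A \<sigma> u = c" for c
    using that assms(2) by simp
qed

locale finite_strongly_Fregean =
  fixes ar :: "'f \<Rightarrow> nat" and u :: "'f trm" and A :: "('f, 'a) ualg"
  assumes strongly_Fregean: "strongly_Fregean ar u A" and finite_carrier: "finite (carrier A)"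
begin

abbreviation "Cong \<equiv> congruences ar A"

abbreviation unit :: 'a ("\<epsilon>") where "\<epsilon> \<equiv> const_val A u"

abbreviation join_A :: "'a rel \<Rightarrow> 'a rel \<Rightarrow> 'a rel" (infixl "\<curlyvee>" 65) where
  "\<alpha> \<curlyvee> \<beta> \<equiv> cong_join ar A \<alpha> \<beta>"

lemma algebra_A: "ualgebra ar A"
  using strongly_Fregean by (simp add: strongly_Fregean_def)

lemma unit_constant: "constant_trm ar A u"
  using strongly_Fregean by (simp add: strongly_Fregean_def)

lemma finite_Cong: "finite Cong"
  by (rule finite_subset[OF _ finite_Pow_iff[THEN iffD2, OF finite_cartesian_product[OF finite_carrier finite_carrier]]])
    (auto dest: congruence_subset)

lemma unit_eq: "range \<rho> \<subseteq> carrier A \<Longrightarrow> \<epsilon> = eval_trm A \<rho> u"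
  by (rule const_val_eq[OF unit_constant])

lemma unit_carrier: "\<epsilon> \<in> carrier A"
proof -
  obtain x where x: "x \<in> carrier A" using algebra_A by (auto simp: ualgebra_def)
  then have r: "range (\<lambda>_ :: nat. x) \<subseteq> carrier A" by auto
  show ?thesis unfolding unit_eq[OF r]
    using eval_trm_closed[OF algebra_A r] unit_constant by (simp add: constant_trm_def)
qed

lemma join_Cong: "\<alpha> \<in> Cong \<Longrightarrow> \<beta> \<in> Cong \<Longrightarrow> \<alpha> \<curlyvee> \<beta> \<in> Cong"
  by (rule cong_join_congruence[OF algebra_A])

lemma modular_Cong:
  assumes "\<alpha> \<in> Cong" "\<beta> \<in> Cong" "\<gamma> \<in> Cong" "\<alpha> \<subseteq> \<gamma>"
  shows "(\<alpha> \<curlyvee> \<beta>) \<inter> \<gamma> = \<alpha> \<curlyvee> (\<beta> \<inter> \<gamma>)"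
proof
  have "in_generated_variety ar A A" using algebra_A by (simp add: in_generated_variety_def)
  then show "(\<alpha> \<curlyvee> \<beta>) \<inter> \<gamma> \<subseteq> \<alpha> \<curlyvee> (\<beta> \<inter> \<gamma>)"
    using strongly_Fregean assms finite_carrier by (intro modular_law) (simp_all add: strongly_Fregean_def)
  show "\<alpha> \<curlyvee> (\<beta> \<inter> \<gamma>) \<subseteq> (\<alpha> \<curlyvee> \<beta>) \<inter> \<gamma>"
    using cong_join_upper[where \<alpha>=\<alpha> and \<beta>=\<beta> and ar=ar and A=A] assms
    by (intro cong_join_least Int_congruence join_Cong) auto
qed

lemma regular_subset:
  assumes \<alpha>: "\<alpha> \<in> Cong" and \<beta>: "\<beta> \<in> Cong" and le: "\<And>x. (\<epsilon>, x) \<in> \<alpha> \<Longrightarrow> (\<epsilon>, x) \<in> \<beta>"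
  shows "\<alpha> \<subseteq> \<beta>"
proof -
  have "surj_hom ar A A id" by (simp add: surj_hom_def)
  then have "point_regular ar u A"
    using strongly_Fregean algebra_A unfolding strongly_Fregean_def Fregean_def by blast
  moreover have "(\<alpha> \<inter> \<beta>) `` {\<epsilon>} = \<alpha> `` {\<epsilon>}" using le by auto
  ultimately have "\<alpha> \<inter> \<beta> = \<alpha>"
    using \<alpha> Int_congruence[OF \<alpha> \<beta>] unfolding point_regular_def by blast
  then show ?thesis by blast
qed

text \<open>
  This is congruence orderability of the quotient by \<open>\<alpha>\<close>, expressed by the congruences of \<open>A\<close>
  above \<open>\<alpha>\<close>.
\<close>

lemma orderable_above:
  assumes \<alpha>: "\<alpha> \<in> Cong" and ab: "a \<in> carrier A" "b \<in> carrier A"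
    and iff: "\<And>\<theta>. \<theta> \<in> Cong \<Longrightarrow> \<alpha> \<subseteq> \<theta> \<Longrightarrow> (\<epsilon>, a) \<in> \<theta> \<longleftrightarrow> (\<epsilon>, b) \<in> \<theta>"
  shows "(a, b) \<in> \<alpha>"
proof -
  define h where "h = (\<lambda>x. SOME y. (x, y) \<in> \<alpha>)"
  have h: "(x, h x) \<in> \<alpha>" if "x \<in> carrier A" for x
    unfolding h_def using congruence_refl[OF \<alpha> that] by (rule someI)
  have h_eq: "h x = h y \<longleftrightarrow> (x, y) \<in> \<alpha>" if "x \<in> carrier A" "y \<in> carrier A" for x y
  proof
    assume "h x = h y"
    then show "(x, y) \<in> \<alpha>"
      using h[OF that(1)] h[OF that(2)] congruence_trans[OF \<alpha>] congruence_sym[OF \<alpha>] by metis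
  next
    assume "(x, y) \<in> \<alpha>"
    then have "(x, z) \<in> \<alpha> \<longleftrightarrow> (y, z) \<in> \<alpha>" for z
      using congruence_trans[OF \<alpha>] congruence_sym[OF \<alpha>] by metis
    then show "h x = h y" by (simp add: h_def)
  qed
  have "{(x, y) \<in> carrier A \<times> carrier A. h x = h y} = \<alpha>"
    using h_eq congruence_subset[OF \<alpha>] by auto
  with \<alpha> have ker: "{(x, y) \<in> carrier A \<times> carrier A. h x = h y} \<in> Cong" by simp
  define B where "B = hom_image A h"
  have B: "ualgebra ar B" and hom: "surj_hom ar A B h"
    unfolding B_def by (rule hom_image[OF algebra_A ker])+
  have cB: "carrier B = h ` carrier A" by (simp add: B_def hom_image_def)
  have "Fregean ar u B" using strongly_Fregean B hom unfolding strongly_Fregean_def by blast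
  then have ord: "congruence_orderable ar u B" by (simp add: Fregean_def)
  have wf: "wf_trm ar u" using unit_constant by (simp add: constant_trm_def)
  have ev: "eval_trm B \<rho> u = h \<epsilon>" if r: "range \<rho> \<subseteq> carrier B" for \<rho>
  proof -
    obtain \<sigma> where \<sigma>: "range \<sigma> \<subseteq> carrier A" "\<rho> = h \<circ> \<sigma>" by (rule lift_valuation[OF hom r])
    show ?thesis unfolding \<sigma>(2) eval_trm_hom[OF algebra_A hom \<sigma>(1) wf] unit_eq[OF \<sigma>(1)] ..
  qed
  have "constant_trm ar B u" using wf ev by (simp add: constant_trm_def)
  moreover have r: "range (\<lambda>_ :: nat. h \<epsilon>) \<subseteq> carrier B" using unit_carrier by (auto simp: cB)
  ultimately have unit_B: "const_val B u = h \<epsilon>" using const_val_eq[of ar B u] ev[OF r] by metis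
  have "(h \<epsilon>, h a) \<in> \<theta> \<longleftrightarrow> (h \<epsilon>, h b) \<in> \<theta>" if \<theta>: "\<theta> \<in> congruences ar B" for \<theta>
  proof -
    let ?\<theta> = "{(x, y) \<in> carrier A \<times> carrier A. (h x, h y) \<in> \<theta>}"
    have "\<alpha> \<subseteq> ?\<theta>"
    proof (rule subrelI)
      fix x y assume xy: "(x, y) \<in> \<alpha>"
      then have "x \<in> carrier A" "y \<in> carrier A" "h x = h y"
        using congruence_carrier[OF \<alpha> xy] h_eq by auto
      then show "(x, y) \<in> ?\<theta>" using congruence_refl[OF \<theta>, of "h y"] by (simp add: cB)
    qed
    then show ?thesis
      using iff[OF congruence_pullback[OF algebra_A hom \<theta>]] ab unit_carrier by simp
  qed
  then have "principal_congruence ar B (h \<epsilon>) (h a) = principal_congruence ar B (h \<epsilon>) (h b)"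
    unfolding principal_congruence_def by (intro arg_cong[of _ _ Inter]) auto
  then have "h a = h b"
    using ord ab unfolding congruence_orderable_def unit_B by (auto simp: cB)
  then show ?thesis using h_eq ab by simp
qed

definition covered_by :: "'a rel \<Rightarrow> 'a rel \<Rightarrow> bool" (infix "\<lless>" 50) where
  "\<alpha> \<lless> \<beta> \<longleftrightarrow> \<alpha> \<in> Cong \<and> \<beta> \<in> Cong \<and> \<alpha> \<subset> \<beta> \<and> (\<forall>\<theta>\<in>Cong. \<alpha> \<subseteq> \<theta> \<and> \<theta> \<subseteq> \<beta> \<longrightarrow> \<theta> = \<alpha> \<or> \<theta> = \<beta>)"

lemma covered_byD:
  assumes "\<alpha> \<lless> \<beta>"
  shows "\<alpha> \<in> Cong" "\<beta> \<in> Cong" "\<alpha> \<subseteq> \<beta>" "\<not> \<beta> \<subseteq> \<alpha>"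
    "\<theta> \<in> Cong \<Longrightarrow> \<alpha> \<subseteq> \<theta> \<Longrightarrow> \<theta> \<subseteq> \<beta> \<Longrightarrow> \<theta> = \<alpha> \<or> \<theta> = \<beta>"
  using assms by (auto simp: covered_by_def)

lemma covered_by_Int:
  assumes "\<alpha> \<lless> \<beta>" "\<theta> \<in> Cong" "\<alpha> \<subseteq> \<theta>" "\<not> \<beta> \<subseteq> \<theta>"
  shows "\<beta> \<inter> \<theta> = \<alpha>"
  using covered_byD(5)[OF assms(1) Int_congruence[OF covered_byD(2)[OF assms(1)] assms(2)]]
    covered_byD(3)[OF assms(1)] assms(3,4) by blast

lemma covered_by_join:
  assumes "\<alpha> \<lless> \<beta>" "\<theta> \<in> Cong" "\<theta> \<subseteq> \<beta>" "\<not> \<theta> \<subseteq> \<alpha>"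
  shows "\<alpha> \<curlyvee> \<theta> = \<beta>"
proof -
  have "\<alpha> \<curlyvee> \<theta> \<subseteq> \<beta>" using covered_byD[OF assms(1)] assms(3) by (intro cong_join_least) auto
  then show ?thesis
    using covered_byD(5)[OF assms(1) join_Cong[OF covered_byD(1)[OF assms(1)] assms(2)]] assms(4)
      cong_join_upper[of \<alpha> ar A \<theta>] cong_join_upper[of \<theta> ar A \<alpha>] by blast
qed

text \<open>
  In \<open>A/\<alpha>\<close> the class of the unit modulo an atom has only one element besides the unit: any two
  such elements generate, together with the unit, the same congruence.
\<close>

lemma covered_by_two_classes:
  assumes c: "\<alpha> \<lless> \<beta>" and x: "(\<epsilon>, x) \<in> \<beta>" "(\<epsilon>, x) \<notin> \<alpha>" and y: "(\<epsilon>, y) \<in> \<beta>" "(\<epsilon>, y) \<notin> \<alpha>"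
  shows "(x, y) \<in> \<alpha>"
proof (rule orderable_above[OF covered_byD(1)[OF c]])
  show "x \<in> carrier A" "y \<in> carrier A"
    using x y congruence_carrier[OF covered_byD(2)[OF c]] by auto
  fix \<theta> assume \<theta>: "\<theta> \<in> Cong" "\<alpha> \<subseteq> \<theta>"
  have "\<beta> \<subseteq> \<theta>" if "(\<epsilon>, z) \<in> \<theta>" "(\<epsilon>, z) \<in> \<beta>" "(\<epsilon>, z) \<notin> \<alpha>" for z
    using covered_by_Int[OF c \<theta>] that by blast
  then show "(\<epsilon>, x) \<in> \<theta> \<longleftrightarrow> (\<epsilon>, y) \<in> \<theta>" using x y by blast
qed

abbreviation "MI \<equiv> Cm (Con ar A)"
abbreviation "cover \<equiv> upper_cover (Con ar A)"

lemma MI_cover: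
  assumes "\<eta> \<in> MI"
  shows MI_Cong: "\<eta> \<in> Cong" and cover_Cong: "cover \<eta> \<in> Cong"
    and cover_greater: "\<eta> \<subset> cover \<eta>"
    and cover_least: "\<theta> \<in> Cong \<Longrightarrow> \<eta> \<subset> \<theta> \<Longrightarrow> cover \<eta> \<subseteq> \<theta>"
proof -
  show \<eta>: "\<eta> \<in> Cong" using assms by (simp add: Cm_def)
  define S where "S = {\<theta> \<in> Cong. \<eta> \<subset> \<theta>}"
  define \<mu> where "\<mu> = (carrier A \<times> carrier A) \<inter> \<Inter>S"
  have S: "S \<subseteq> Cong" by (auto simp: S_def)
  have "\<mu> = \<Sqinter>\<^bsub>Con ar A\<^esub>S" unfolding \<mu>_def by (rule Con_Inf[OF algebra_A S, symmetric])
  moreover have "\<eta> \<notin> S" by (simp add: S_def)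
  ultimately have ne: "\<eta> \<noteq> \<mu>" using assms S unfolding Cm_def by auto
  have "\<mu> = \<Inter>(insert (carrier A \<times> carrier A) S)" by (simp add: \<mu>_def)
  also have "\<dots> \<in> Cong" using S full_congruence[OF algebra_A] by (intro Inter_congruence) auto
  finally have \<mu>: "\<mu> \<in> Cong" .
  have "\<eta> \<subseteq> \<mu>" using congruence_subset[OF \<eta>] by (auto simp: \<mu>_def S_def)
  with ne have lt: "\<eta> \<subset> \<mu>" by blast
  have least: "\<mu> \<subseteq> \<theta>" if "\<theta> \<in> Cong" "\<eta> \<subset> \<theta>" for \<theta> using that by (auto simp: \<mu>_def S_def)
  have strict: "{\<theta> \<in> carrier (Con ar A). \<eta> \<sqsubset>\<^bsub>Con ar A\<^esub> \<theta>} = S"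
    by (auto simp: S_def lless_def)
  have "cover \<eta> = \<mu>"
    unfolding upper_cover_def strict
  proof (rule the_equality)
    show "least (Con ar A) \<mu> S" using S \<mu> lt least by (auto simp: least_def S_def)
    show "\<theta> = \<mu>" if "least (Con ar A) \<theta> S" for \<theta>
      using that \<mu> lt least by (intro subset_antisym) (auto simp: least_def S_def)
  qed
  with \<mu> lt least show "cover \<eta> \<in> Cong" "\<eta> \<subset> cover \<eta>"
    "\<theta> \<in> Cong \<Longrightarrow> \<eta> \<subset> \<theta> \<Longrightarrow> cover \<eta> \<subseteq> \<theta>" by auto
qed

lemma covered_by_cover: "\<eta> \<in> MI \<Longrightarrow> \<eta> \<lless> cover \<eta>"
  unfolding covered_by_def using MI_cover[of \<eta>] by blast

text \<open>
  A congruence that is maximal among those above \<open>\<alpha>\<close> and not above \<open>\<beta>\<close> is meet irreducible, because all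
  larger ones contain \<open>\<beta>\<close>.
\<close>

lemma MI_separating:
  assumes \<alpha>: "\<alpha> \<in> Cong" and \<beta>: "\<beta> \<in> Cong" and le: "\<not> \<beta> \<subseteq> \<alpha>"
  obtains \<eta> where "\<eta> \<in> MI" "\<alpha> \<subseteq> \<eta>" "\<not> \<beta> \<subseteq> \<eta>" "\<beta> \<subseteq> cover \<eta>"
proof -
  define M where "M = {\<theta> \<in> Cong. \<alpha> \<subseteq> \<theta> \<and> \<not> \<beta> \<subseteq> \<theta>}"
  have "finite M" "M \<noteq> {}" using finite_Cong \<alpha> le by (auto simp: M_def)
  then obtain \<eta> where \<eta>M: "\<eta> \<in> M" and max: "\<forall>\<theta>\<in>M. \<eta> \<subseteq> \<theta> \<longrightarrow> \<eta> = \<theta>"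
    using finite_has_maximal[of M] by auto
  from \<eta>M have \<eta>: "\<eta> \<in> Cong" "\<alpha> \<subseteq> \<eta>" "\<not> \<beta> \<subseteq> \<eta>" by (simp_all add: M_def)
  have above: "\<beta> \<subseteq> \<theta>" if "\<theta> \<in> Cong" "\<eta> \<subset> \<theta>" for \<theta>
  proof (rule ccontr)
    assume "\<not> \<beta> \<subseteq> \<theta>"
    then have "\<theta> \<in> M" using that \<eta>(2) by (auto simp: M_def)
    with max that(2) show False by auto
  qed
  have "\<eta> \<in> MI"
    unfolding Cm_def
  proof (intro CollectI conjI allI impI)
    show "\<eta> \<in> carrier (Con ar A)" using \<eta> by simp
    fix S assume S: "S \<subseteq> carrier (Con ar A) \<and> \<eta> = \<Sqinter>\<^bsub>Con ar A\<^esub>S"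
    then have eq: "\<eta> = (carrier A \<times> carrier A) \<inter> \<Inter>S" using Con_Inf[OF algebra_A, of S] by simp
    show "\<eta> \<in> S"
    proof (rule ccontr)
      assume "\<eta> \<notin> S"
      have "\<eta> \<subseteq> \<Inter>S" by (subst eq) (rule Int_lower2)
      then have "\<eta> \<subset> \<theta>" if "\<theta> \<in> S" for \<theta>
        using that \<open>\<eta> \<notin> S\<close> by blast
      then have "\<beta> \<subseteq> \<Inter>S" using S by (intro Inter_greatest above) auto
      then have "\<beta> \<subseteq> \<eta>" using congruence_subset[OF \<beta>] by (subst eq) (rule Int_greatest)
      with \<eta> show False by simp
    qed
  qed
  moreover from this have "\<beta> \<subseteq> cover \<eta>" by (intro above cover_Cong cover_greater)
  ultimately show ?thesis using that \<eta> by simp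
qed

text \<open>
  The monolith of the subdirectly irreducible algebra \<open>A/\<eta>\<close> identifies nothing outside the class of the unit:
  if it relates \<open>x\<close> and \<open>y\<close>, then so does every nontrivial congruence, and hence \<open>x\<close> and \<open>y\<close> cannot be
  distinguished by the congruences they generate with the unit.
\<close>

lemma cover_trivial_off_unit_class:
  assumes \<eta>: "\<eta> \<in> MI" and xy: "(x, y) \<in> cover \<eta>" and x: "(\<epsilon>, x) \<notin> cover \<eta>"
  shows "(x, y) \<in> \<eta>"
proof (rule orderable_above[OF MI_Cong[OF \<eta>]])
  show "x \<in> carrier A" "y \<in> carrier A" using congruence_carrier[OF cover_Cong[OF \<eta>] xy] .
  have y: "(\<epsilon>, y) \<notin> cover \<eta>"
    using x congruence_sym[OF cover_Cong[OF \<eta>] xy] congruence_trans[OF cover_Cong[OF \<eta>], of \<epsilon> y x] by auto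
  fix \<theta> assume \<theta>: "\<theta> \<in> Cong" "\<eta> \<subseteq> \<theta>"
  show "(\<epsilon>, x) \<in> \<theta> \<longleftrightarrow> (\<epsilon>, y) \<in> \<theta>"
  proof (cases "\<theta> = \<eta>")
    case True
    then show ?thesis using x y cover_greater[OF \<eta>] by blast
  next
    case False
    then have "(x, y) \<in> \<theta>" using xy cover_least[OF \<eta> \<theta>(1)] \<theta>(2) by auto
    then show ?thesis
      using congruence_trans[OF \<theta>(1), of \<epsilon> x y] congruence_trans[OF \<theta>(1), of \<epsilon> y x]
        congruence_sym[OF \<theta>(1), of x y] by auto
  qed
qed

end

section \<open>Projectivity of the covers of meet irreducibles\<close>

lemma cong_join_commute: "cong_join ar A \<alpha> \<beta> = cong_join ar A \<beta> \<alpha>"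
  by (simp add: cong_join_def conj_commute)

context finite_strongly_Fregean
begin

text \<open>Modularity makes transposed intervals isomorphic, so transposition preserves covers.\<close>

lemma covered_by_transpose_up:
  assumes c: "\<alpha> \<lless> \<beta>" and \<gamma>: "\<gamma> \<in> Cong" and eq: "\<beta> \<inter> \<gamma> = \<alpha>"
  shows "\<gamma> \<lless> \<beta> \<curlyvee> \<gamma>"
  unfolding covered_by_def
proof (intro conjI ballI impI)
  note \<beta> = covered_byD(2)[OF c]
  show "\<gamma> \<in> Cong" "\<beta> \<curlyvee> \<gamma> \<in> Cong" using \<beta> \<gamma> by (auto intro: join_Cong)
  have "\<not> \<beta> \<subseteq> \<gamma>" using covered_byD(4)[OF c] eq by blast
  moreover have "\<beta> \<subseteq> \<beta> \<curlyvee> \<gamma>" "\<gamma> \<subseteq> \<beta> \<curlyvee> \<gamma>" by (rule cong_join_upper)+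
  ultimately show "\<gamma> \<subset> \<beta> \<curlyvee> \<gamma>" by auto
  fix \<theta> assume \<theta>: "\<theta> \<in> Cong" and le: "\<gamma> \<subseteq> \<theta> \<and> \<theta> \<subseteq> \<beta> \<curlyvee> \<gamma>"
  have eq': "\<theta> = \<gamma> \<curlyvee> (\<beta> \<inter> \<theta>)"
    using modular_Cong[OF \<gamma> \<beta> \<theta>] le cong_join_commute[of ar A \<beta> \<gamma>] by (simp add: Int_absorb1)
  have "\<alpha> \<subseteq> \<beta> \<inter> \<theta>" using eq le by blast
  then have "\<beta> \<inter> \<theta> = \<alpha> \<or> \<beta> \<inter> \<theta> = \<beta>"
    using covered_byD(5)[OF c Int_congruence[OF \<beta> \<theta>]] by simp
  then show "\<theta> = \<gamma> \<or> \<theta> = \<beta> \<curlyvee> \<gamma>"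
  proof
    assume "\<beta> \<inter> \<theta> = \<alpha>"
    then have "\<gamma> \<curlyvee> (\<beta> \<inter> \<theta>) \<subseteq> \<gamma>" using eq \<gamma> by (intro cong_join_least) auto
    then show ?thesis using eq' le by auto
  next
    assume "\<beta> \<inter> \<theta> = \<beta>"
    then show ?thesis using eq' by (simp add: cong_join_commute)
  qed
qed

lemma covered_by_transpose_down:
  assumes c: "\<gamma> \<lless> \<beta> \<curlyvee> \<gamma>" and \<beta>: "\<beta> \<in> Cong"
  shows "\<beta> \<inter> \<gamma> \<lless> \<beta>"
  unfolding covered_by_def
proof (intro conjI ballI impI)
  note \<gamma> = covered_byD(1)[OF c]
  show "\<beta> \<in> Cong" "\<beta> \<inter> \<gamma> \<in> Cong" using \<beta> \<gamma> by (auto intro: Int_congruence)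
  have "\<not> \<beta> \<subseteq> \<gamma>"
  proof
    assume "\<beta> \<subseteq> \<gamma>"
    then have "\<beta> \<curlyvee> \<gamma> \<subseteq> \<gamma>" using \<gamma> by (intro cong_join_least) auto
    with covered_byD(4)[OF c] show False ..
  qed
  then show "\<beta> \<inter> \<gamma> \<subset> \<beta>" by blast
  fix \<theta> assume \<theta>: "\<theta> \<in> Cong" and le: "\<beta> \<inter> \<gamma> \<subseteq> \<theta> \<and> \<theta> \<subseteq> \<beta>"
  have "\<theta> \<curlyvee> \<gamma> \<subseteq> \<beta> \<curlyvee> \<gamma>"
    using le cong_join_upper[where \<alpha>=\<beta> and \<beta>=\<gamma> and ar=ar and A=A] \<beta> \<gamma>
    by (intro cong_join_least join_Cong) auto
  then have "\<theta> \<curlyvee> \<gamma> = \<gamma> \<or> \<theta> \<curlyvee> \<gamma> = \<beta> \<curlyvee> \<gamma>"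
    using covered_byD(5)[OF c join_Cong[OF \<theta> \<gamma>] cong_join_upper(2)] by simp
  moreover have "(\<theta> \<curlyvee> \<gamma>) \<inter> \<beta> = \<theta>"
  proof -
    have "\<theta> \<curlyvee> (\<gamma> \<inter> \<beta>) \<subseteq> \<theta>" using le \<theta> by (intro cong_join_least) auto
    then show ?thesis
      using modular_Cong[OF \<theta> \<gamma> \<beta>] le cong_join_upper(1)[of \<theta> ar A "\<gamma> \<inter> \<beta>"] by auto
  qed
  ultimately show "\<theta> = \<beta> \<inter> \<gamma> \<or> \<theta> = \<beta>"
    using cong_join_upper(1)[of \<beta> ar A \<gamma>] by blast
qed

lemma covered_by_same_eq:
  assumes "\<phi> \<lless> \<mu>" "\<psi> \<lless> \<mu>" "\<phi> \<subseteq> \<psi>"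
  shows "\<phi> = \<psi>"
  using covered_byD(5)[OF assms(1) covered_byD(1)[OF assms(2)] assms(3) covered_byD(3)[OF assms(2)]]
    covered_byD(4)[OF assms(2)] by auto

lemma covered_by_same_meet:
  assumes "\<phi> \<lless> \<mu>" "\<psi> \<lless> \<mu>" "\<phi> \<noteq> \<psi>"
  shows "\<phi> \<inter> \<psi> \<lless> \<phi>"
proof (rule covered_by_transpose_down)
  have "\<not> \<phi> \<subseteq> \<psi>" using covered_by_same_eq assms by blast
  then have "\<phi> \<curlyvee> \<psi> = \<mu>"
    using covered_by_join[OF assms(2) covered_byD(1)[OF assms(1)] covered_byD(3)[OF assms(1)]]
    by (simp add: cong_join_commute)
  then show "\<psi> \<lless> \<phi> \<curlyvee> \<psi>" using assms(2) by simp
qed (rule covered_byD(1)[OF assms(1)])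

text \<open>
  The interval \<open>I[\<beta> \<inter> \<phi>, \<beta>]\<close> transposes up both to \<open>I[\<phi>, \<phi>\<^sup>+]\<close> and to \<open>I[\<psi>, \<psi>\<^sup>+]\<close>. This is the case of
  projectivity in two steps, to which the general case will be reduced.
\<close>

definition linked :: "'a rel \<Rightarrow> 'a rel \<Rightarrow> bool" where
  "linked \<phi> \<psi> \<longleftrightarrow> \<phi> \<in> MI \<and> \<psi> \<in> MI \<and>
     (\<exists>\<beta>\<in>Cong. \<beta> \<inter> \<phi> = \<beta> \<inter> \<psi> \<and> \<not> \<beta> \<subseteq> \<phi> \<and> \<beta> \<subseteq> cover \<phi> \<and> \<beta> \<subseteq> cover \<psi>)"

lemma linkedI:
  "\<phi> \<in> MI \<Longrightarrow> \<psi> \<in> MI \<Longrightarrow> \<beta> \<in> Cong \<Longrightarrow> \<beta> \<inter> \<phi> = \<beta> \<inter> \<psi> \<Longrightarrow> \<not> \<beta> \<subseteq> \<phi> \<Longrightarrow> \<beta> \<subseteq> cover \<phi> \<Longrightarrow>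
    \<beta> \<subseteq> cover \<psi> \<Longrightarrow> linked \<phi> \<psi>"
  unfolding linked_def by (intro conjI bexI[of _ \<beta>])

lemma linked_MI: "linked \<phi> \<psi> \<Longrightarrow> \<phi> \<in> MI" "linked \<phi> \<psi> \<Longrightarrow> \<psi> \<in> MI"
  by (simp_all add: linked_def)

lemma linkedE:
  assumes "linked \<phi> \<psi>"
  obtains \<beta> where "\<phi> \<in> MI" "\<psi> \<in> MI" "\<beta> \<in> Cong" "\<beta> \<inter> \<phi> = \<beta> \<inter> \<psi>" "\<not> \<beta> \<subseteq> \<phi>" "\<not> \<beta> \<subseteq> \<psi>"
    "\<beta> \<subseteq> cover \<phi>" "\<beta> \<subseteq> cover \<psi>"
proof -
  obtain \<beta> where b: "\<beta> \<in> Cong" "\<beta> \<inter> \<phi> = \<beta> \<inter> \<psi>" "\<not> \<beta> \<subseteq> \<phi>" "\<beta> \<subseteq> cover \<phi>" "\<beta> \<subseteq> cover \<psi>"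
    using assms unfolding linked_def by (elim conjE bexE)
  have "\<not> \<beta> \<subseteq> \<psi>"
  proof
    assume "\<beta> \<subseteq> \<psi>"
    then have "\<beta> \<inter> \<psi> = \<beta>" by (rule Int_absorb2)
    with b(2,3) show False by (metis inf_le2)
  qed
  with b linked_MI[OF assms] show ?thesis by (intro that)
qed

lemma linked_refl: "\<phi> \<in> MI \<Longrightarrow> linked \<phi> \<phi>"
  using MI_cover[of \<phi>] by (intro linkedI[of _ _ "cover \<phi>"]) (auto simp: psubset_eq)

lemma linked_sym: "linked \<phi> \<psi> \<Longrightarrow> linked \<psi> \<phi>"
  by (erule linkedE) (rule linkedI, simp_all)

text \<open>
  Suppose that \<open>\<phi>\<close> is not below the cover of \<open>\<psi>\<close>, so that some \<open>b\<close> in its unit class is outside the unit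
  class of this cover. Then \<open>\<phi> \<or> \<psi>\<close> contains the cover of \<open>\<psi>\<close> and hence \<open>\<beta>\<close>, and \<open>modular_corner\<close>
  gives \<open>b \<beta> c \<phi> s\<close>. But away from the unit class \<open>\<beta>\<close> is contained in \<open>\<psi>\<close>, which makes \<open>(b, c)\<close> an element of
  \<open>\<beta> \<inter> \<psi> \<subseteq> \<phi>\<close> and forces \<open>s\<close> into the \<open>\<phi>\<close>-class of the unit.
\<close>

lemma cover_subset_if_linked:
  assumes \<phi>: "\<phi> \<in> MI" and \<psi>: "\<psi> \<in> MI" and \<beta>: "\<beta> \<in> Cong" and eq: "\<beta> \<inter> \<phi> = \<beta> \<inter> \<psi>"
    and not_le: "\<not> \<beta> \<subseteq> \<phi>" and le: "\<beta> \<subseteq> cover \<psi>"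
  shows "cover \<phi> \<subseteq> cover \<psi>"
proof -
  note C = MI_Cong[OF \<phi>] MI_Cong[OF \<psi>] cover_Cong[OF \<psi>]
  have "\<phi> \<subseteq> cover \<psi>"
  proof (rule ccontr)
    assume "\<not> \<phi> \<subseteq> cover \<psi>"
    then obtain b where b: "(\<epsilon>, b) \<in> \<phi>" "(\<epsilon>, b) \<notin> cover \<psi>"
      using regular_subset[OF C(1,3)] by blast
    obtain a where a: "(\<epsilon>, a) \<in> \<beta>" "(\<epsilon>, a) \<notin> \<phi>"
      using regular_subset[OF \<beta> C(1)] not_le by blast
    have "\<psi> \<subset> \<phi> \<curlyvee> \<psi>"
      using \<open>\<not> \<phi> \<subseteq> cover \<psi>\<close> cover_greater[OF \<psi>] cong_join_upper[where \<alpha>=\<phi> and \<beta>=\<psi> and ar=ar and A=A]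
      by auto
    then have "cover \<psi> \<subseteq> \<phi> \<curlyvee> \<psi>" by (rule cover_least[OF \<psi> join_Cong[OF C(1,2)]])
    with a le have "(\<epsilon>, a) \<in> \<phi> \<curlyvee> \<psi>" by auto
    moreover have "generates_congruence_modular ar A"
      using strongly_Fregean by (simp add: strongly_Fregean_def)
    ultimately obtain c s where cs: "(b, c) \<in> \<beta>" "(c, s) \<in> \<phi>" "(\<epsilon>, s) \<in> \<beta>" "(\<epsilon>, s) \<notin> \<phi>"
      using modular_corner[OF _ algebra_A finite_carrier C(1,2) \<beta> eq b(1) a(1) _ a(2)] by blast
    have "(b, c) \<in> \<psi>"
      using cs(1) le b(2) by (intro cover_trivial_off_unit_class[OF \<psi>]) auto
    with cs(1) eq have "(b, c) \<in> \<phi>" by auto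
    then have "(\<epsilon>, s) \<in> \<phi>" using congruence_trans[OF C(1)] b(1) cs(2) by metis
    with cs(4) show False ..
  qed
  then have "\<phi> \<curlyvee> \<beta> \<subseteq> cover \<psi>" using le C by (intro cong_join_least)
  moreover have "\<phi> \<subset> \<phi> \<curlyvee> \<beta>"
    using not_le cong_join_upper[where \<alpha>=\<phi> and \<beta>=\<beta> and ar=ar and A=A] by auto
  then have "cover \<phi> \<subseteq> \<phi> \<curlyvee> \<beta>" by (rule cover_least[OF \<phi> join_Cong[OF C(1) \<beta>]])
  ultimately show ?thesis by simp
qed

lemma linked_cover_eq:
  assumes "linked \<phi> \<psi>"
  shows "cover \<phi> = cover \<psi>"
  using assms
proof (rule linkedE)
  fix \<beta>
  assume "\<phi> \<in> MI" "\<psi> \<in> MI" "\<beta> \<in> Cong" "\<beta> \<inter> \<phi> = \<beta> \<inter> \<psi>" "\<not> \<beta> \<subseteq> \<phi>" "\<not> \<beta> \<subseteq> \<psi>"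
    "\<beta> \<subseteq> cover \<phi>" "\<beta> \<subseteq> cover \<psi>"
  then show ?thesis
    using cover_subset_if_linked[of \<phi> \<psi> \<beta>] cover_subset_if_linked[of \<psi> \<phi> \<beta>] by auto
qed

text \<open>The operation \<open>\<bullet>\<close> of the Boolean group with unit \<open>\<mu>\<close>, for relations contained in \<open>\<mu>\<close>.\<close>

definition agree :: "'a rel \<Rightarrow> 'a rel \<Rightarrow> 'a rel \<Rightarrow> 'a rel" where
  "agree \<mu> \<phi> \<psi> = {p \<in> \<mu>. p \<in> \<phi> \<longleftrightarrow> p \<in> \<psi>}"

text \<open>
  A pair that is in \<open>\<mu>\<close> but not in \<open>\<phi>\<close> lies in the unit class of \<open>\<mu>\<close>. As \<open>\<phi>\<close> and \<open>\<psi>\<close> split that class into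
  two parts each, \<open>\<phi> \<inter> \<psi>\<close> splits it into four. The congruence \<open>\<chi>\<close> also splits it into two parts and cannot relate elements
  that \<open>\<phi>\<close> or \<open>\<psi>\<close> alone relates; so it joins the four parts along the diagonals.
\<close>

lemma diagonal_eq_agree:
  assumes \<phi>: "\<phi> \<in> MI" "cover \<phi> = \<mu>" and \<psi>: "\<psi> \<lless> \<mu>" and \<chi>: "\<chi> \<lless> \<mu>" and ne: "\<phi> \<noteq> \<psi>"
    and eq: "\<chi> \<inter> \<phi> = \<phi> \<inter> \<psi>" "\<chi> \<inter> \<psi> = \<phi> \<inter> \<psi>"
  shows "\<chi> = agree \<mu> \<phi> \<psi>"
proof
  show "\<chi> \<subseteq> agree \<mu> \<phi> \<psi>" using eq covered_byD(3)[OF \<chi>] by (auto simp: agree_def)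
next
  have c\<phi>: "\<phi> \<lless> \<mu>" using covered_by_cover[OF \<phi>(1)] \<phi>(2) by simp
  note C = covered_byD(1)[OF c\<phi>] covered_byD(1)[OF \<psi>] covered_byD(1)[OF \<chi>] covered_byD(2)[OF \<chi>]
  have both: "(x, y) \<in> \<chi>" if "(x, y) \<in> \<phi>" "(x, y) \<in> \<psi>" for x y using eq(1) that by blast
  have "\<not> \<chi> \<subseteq> \<phi> \<inter> \<psi>"
  proof
    assume "\<chi> \<subseteq> \<phi> \<inter> \<psi>"
    then have "\<chi> = \<phi>" "\<chi> = \<psi>" using covered_by_same_eq[OF \<chi> c\<phi>] covered_by_same_eq[OF \<chi> \<psi>] by auto
    with ne show False by simp
  qed
  \<comment> \<open>A witness that \<open>\<chi>\<close> joins the part of the unit with the opposite one.\<close>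
  then obtain z where z: "(\<epsilon>, z) \<in> \<chi>" "(\<epsilon>, z) \<notin> \<phi> \<inter> \<psi>"
    using regular_subset[OF C(3) Int_congruence[OF C(1,2)]] by blast
  then have z': "(\<epsilon>, z) \<notin> \<phi>" "(\<epsilon>, z) \<notin> \<psi>" "(\<epsilon>, z) \<in> \<mu>" using eq covered_byD(3)[OF \<chi>] by blast+
  have oriented: "(x, y) \<in> \<chi>"
    if xy: "(x, y) \<in> \<mu>" "(x, y) \<notin> \<phi>" "(x, y) \<notin> \<psi>" and x: "(\<epsilon>, x) \<in> \<phi>" for x y
  proof -
    have ex: "(\<epsilon>, x) \<in> \<mu>" using x covered_byD(3)[OF c\<phi>] by blast
    then have ey: "(\<epsilon>, y) \<in> \<mu>" using congruence_trans[OF C(4)] xy(1) by metis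
    have y: "(\<epsilon>, y) \<notin> \<phi>"
      using xy(2) x congruence_trans[OF C(1)] congruence_sym[OF C(1)] by metis
    show ?thesis
    proof (cases "(\<epsilon>, x) \<in> \<psi>")
      case True
      then have "(\<epsilon>, y) \<notin> \<psi>"
        using xy(3) congruence_trans[OF C(2)] congruence_sym[OF C(2)] by metis
      then have "(z, y) \<in> \<chi>"
        using covered_by_two_classes[OF c\<phi> z'(3,1) ey y] covered_by_two_classes[OF \<psi> z'(3,2) ey]
        by (intro both) auto
      then have "(\<epsilon>, y) \<in> \<chi>" using z(1) congruence_trans[OF C(3)] by metis
      moreover have "(\<epsilon>, x) \<in> \<chi>" using x True by (rule both)
      ultimately show ?thesis using congruence_trans[OF C(3)] congruence_sym[OF C(3)] by metis
    next
      case False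
      then have "(\<epsilon>, y) \<in> \<psi>" using covered_by_two_classes[OF \<psi> ex _ ey] xy(3) by blast
      then have "(\<epsilon>, y) \<notin> \<chi>" "(\<epsilon>, x) \<notin> \<chi>" using eq x False y by blast+
      then show ?thesis using covered_by_two_classes[OF \<chi> ex _ ey] by blast
    qed
  qed
  show "agree \<mu> \<phi> \<psi> \<subseteq> \<chi>"
  proof (rule subrelI)
    fix x y assume "(x, y) \<in> agree \<mu> \<phi> \<psi>"
    then have xy: "(x, y) \<in> \<mu>" "(x, y) \<in> \<phi> \<longleftrightarrow> (x, y) \<in> \<psi>" by (simp_all add: agree_def)
    show "(x, y) \<in> \<chi>"
    proof (cases "(x, y) \<in> \<phi>")
      case True
      then show ?thesis using both xy(2) by blast
    next
      case False
      then have ex: "(\<epsilon>, x) \<in> \<mu>"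
        using cover_trivial_off_unit_class[OF \<phi>(1)] xy(1) \<phi>(2) by blast
      have yx: "(y, x) \<in> \<mu>" "(y, x) \<notin> \<phi>" "(y, x) \<notin> \<psi>"
        using xy False congruence_sym[OF C(4)] congruence_sym[OF C(1)] congruence_sym[OF C(2)] by metis+
      have ey: "(\<epsilon>, y) \<in> \<mu>" using congruence_trans[OF C(4) ex xy(1)] .
      consider "(\<epsilon>, x) \<in> \<phi>" | "(\<epsilon>, y) \<in> \<phi>"
        using covered_by_two_classes[OF c\<phi> ex _ ey] False by blast
      then show ?thesis
      proof cases
        case 1
        with xy False show ?thesis by (intro oriented) auto
      next
        case 2
        with yx have "(y, x) \<in> \<chi>" by (intro oriented) auto
        then show ?thesis by (rule congruence_sym[OF C(3)])
      qed
    qed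
  qed
qed

text \<open>
  By modularity \<open>(\<phi> \<inter> \<psi>) \<or> \<beta>\<close> completes \<open>\<phi>\<close> and \<open>\<psi>\<close> to a diamond below their cover \<open>\<mu>\<close>, and so
  is the diagonal. It is meet irreducible because a meet irreducible \<open>\<eta>\<close> that separates it from \<open>\<mu>\<close> is linked
  to \<open>\<phi>\<close>: then \<open>\<mu>\<close> is also the cover of \<open>\<eta>\<close>, which leaves no room between the two.
\<close>

lemma linked_agree:
  assumes l: "linked \<phi> \<psi>" and ne: "\<phi> \<noteq> \<psi>"
  shows "linked (agree (cover \<phi>) \<phi> \<psi>) \<phi>"
proof -
  obtain \<beta> where b: "\<phi> \<in> MI" "\<psi> \<in> MI" "\<beta> \<in> Cong" "\<beta> \<inter> \<phi> = \<beta> \<inter> \<psi>" "\<not> \<beta> \<subseteq> \<phi>" "\<not> \<beta> \<subseteq> \<psi>"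
    "\<beta> \<subseteq> cover \<phi>" "\<beta> \<subseteq> cover \<psi>"
    using l by (rule linkedE)
  define \<mu> where "\<mu> = cover \<phi>"
  have cov: "cover \<phi> = \<mu>" "cover \<psi> = \<mu>" using linked_cover_eq[OF l] by (simp_all add: \<mu>_def)
  have c\<phi>: "\<phi> \<lless> \<mu>" and c\<psi>: "\<psi> \<lless> \<mu>" using covered_by_cover b(1,2) cov by metis+
  note C = MI_Cong[OF b(1)] MI_Cong[OF b(2)]
  define \<chi> where "\<chi> = (\<phi> \<inter> \<psi>) \<curlyvee> \<beta>"
  have \<chi>C: "\<chi> \<in> Cong" unfolding \<chi>_def using C b(3) by (intro join_Cong Int_congruence)
  have up: "\<phi> \<inter> \<psi> \<subseteq> \<chi>" "\<beta> \<subseteq> \<chi>" unfolding \<chi>_def by (rule cong_join_upper)+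
  have "\<chi> \<inter> \<theta> \<subseteq> \<phi> \<inter> \<psi>" if "\<theta> \<in> Cong" "\<phi> \<inter> \<psi> \<subseteq> \<theta>" "\<beta> \<inter> \<theta> \<subseteq> \<phi> \<inter> \<psi>" for \<theta>
    unfolding \<chi>_def modular_Cong[OF Int_congruence[OF C] b(3) that(1,2)]
    using that C by (intro cong_join_least Int_congruence) auto
  from this[OF C(1)] this[OF C(2)] up(1) b(4)
  have eq: "\<chi> \<inter> \<phi> = \<phi> \<inter> \<psi>" "\<chi> \<inter> \<psi> = \<phi> \<inter> \<psi>" by blast+
  have "\<chi> \<subseteq> \<mu>"
    unfolding \<chi>_def using b(7) cov covered_byD(2,3)[OF c\<phi>] by (intro cong_join_least) auto
  moreover have "\<not> \<chi> \<subseteq> \<psi>" using up(2) b(6) by blast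
  ultimately have "\<psi> \<curlyvee> \<chi> = \<mu>" by (rule covered_by_join[OF c\<psi> \<chi>C])
  moreover have "\<psi> \<inter> \<phi> \<lless> \<psi>" using ne by (intro covered_by_same_meet[OF c\<psi> c\<phi>]) simp
  ultimately have c\<chi>: "\<chi> \<lless> \<mu>"
    using covered_by_transpose_up[of "\<psi> \<inter> \<phi>" \<psi> \<chi>] \<chi>C eq(2) by (simp add: Int_commute)
  have \<chi>_agree: "\<chi> = agree (cover \<phi>) \<phi> \<psi>"
    using diagonal_eq_agree[OF b(1) cov(1) c\<psi> c\<chi> ne eq] cov(1) by simp
  obtain \<eta> where \<eta>: "\<eta> \<in> MI" "\<chi> \<subseteq> \<eta>" "\<not> \<mu> \<subseteq> \<eta>" "\<mu> \<subseteq> cover \<eta>"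
    by (rule MI_separating[OF \<chi>C covered_byD(2,4)[OF c\<chi>]])
  have int: "\<mu> \<inter> \<eta> = \<chi>" by (rule covered_by_Int[OF c\<chi> MI_Cong[OF \<eta>(1)] \<eta>(2,3)])
  have "linked \<eta> \<phi>"
  proof (rule linkedI[OF \<eta>(1) b(1) C(2)])
    show e: "\<psi> \<inter> \<eta> = \<psi> \<inter> \<phi>" using int eq(2) covered_byD(3)[OF c\<psi>] by blast
    have "\<not> \<psi> \<subseteq> \<phi>" using covered_by_same_eq[OF c\<psi> c\<phi>] ne by auto
    then show "\<not> \<psi> \<subseteq> \<eta>" using e by blast
    show "\<psi> \<subseteq> cover \<eta>" "\<psi> \<subseteq> cover \<phi>" using covered_byD(3)[OF c\<psi>] \<eta>(4) cov by auto
  qed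
  moreover from this have "cover \<eta> = \<mu>" using linked_cover_eq cov by simp
  then have "\<eta> = \<chi>" using int cover_greater[OF \<eta>(1)] by blast
  ultimately show ?thesis using \<chi>_agree by simp
qed

text \<open>
  In the nontrivial case the common lower interval for \<open>\<phi>\<close> and \<open>\<rho>\<close> ends in \<open>(\<phi> \<bullet> \<psi>) \<inter> (\<psi> \<bullet> \<rho>)\<close>, the relation that
  all three agree or all three disagree, which cannot distinguish \<open>\<phi>\<close> from \<open>\<rho>\<close>. It could be below \<open>\<phi>\<close> only if it
  were too small, which is excluded by counting covers when \<open>\<phi>\<close>, \<open>\<psi>\<close>, \<open>\<rho>\<close> are independent; if they are not,
  \<open>\<rho>\<close> is \<open>\<phi> \<bullet> \<psi>\<close>.
\<close>

lemma linked_trans: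
  assumes l: "linked \<phi> \<psi>" "linked \<psi> \<rho>"
  shows "linked \<phi> \<rho>"
proof (cases "\<phi> = \<psi> \<or> \<psi> = \<rho> \<or> \<phi> = \<rho>")
  case True
  then show ?thesis using l linked_refl[OF linked_MI(1)[OF l(1)]] by metis
next
  case False
  then have ne: "\<phi> \<noteq> \<psi>" "\<psi> \<noteq> \<rho>" "\<phi> \<noteq> \<rho>" by auto
  define \<mu> where "\<mu> = cover \<phi>"
  have cov: "cover \<phi> = \<mu>" "cover \<psi> = \<mu>" "cover \<rho> = \<mu>"
    using linked_cover_eq[OF l(1)] linked_cover_eq[OF l(2)] by (simp_all add: \<mu>_def)
  have MI: "\<phi> \<in> MI" "\<psi> \<in> MI" "\<rho> \<in> MI" using linked_MI[OF l(1)] linked_MI[OF l(2)] by simp_all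
  have c: "\<phi> \<lless> \<mu>" "\<psi> \<lless> \<mu>" "\<rho> \<lless> \<mu>" using covered_by_cover MI cov by metis+
  define \<chi> \<chi>' where "\<chi> = agree \<mu> \<phi> \<psi>" and "\<chi>' = agree \<mu> \<psi> \<rho>"
  have l\<chi>: "linked \<chi> \<phi>" and l\<chi>': "linked \<chi>' \<psi>"
    unfolding \<chi>_def \<chi>'_def using linked_agree[OF l(1) ne(1)] linked_agree[OF l(2) ne(2)] cov by simp_all
  have c\<chi>: "\<chi> \<lless> \<mu>" and c\<chi>': "\<chi>' \<lless> \<mu>"
    using covered_by_cover[of \<chi>] covered_by_cover[of \<chi>'] linked_cover_eq[OF l\<chi>] linked_cover_eq[OF l\<chi>']
      linked_MI(1)[OF l\<chi>] linked_MI(1)[OF l\<chi>'] cov by simp_all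
  have sub: "\<phi> \<subseteq> \<mu>" "\<psi> \<subseteq> \<mu>" "\<rho> \<subseteq> \<mu>" using c covered_byD(3) by blast+
  have ne\<chi>: "\<chi> \<noteq> \<chi>'"
  proof
    assume "\<chi> = \<chi>'"
    then have "p \<in> \<phi> \<longleftrightarrow> p \<in> \<rho>" for p
      using sub unfolding \<chi>_def \<chi>'_def agree_def set_eq_iff mem_Collect_eq by blast
    with ne(3) show False by blast
  qed
  show ?thesis
  proof (cases "\<phi> \<inter> \<psi> \<subseteq> \<rho>")
    case True
    have "\<phi> \<inter> \<rho> = \<phi> \<inter> \<psi>" if "\<phi> \<inter> \<psi> \<subseteq> \<rho>" "\<phi> \<lless> \<mu>" "\<psi> \<lless> \<mu>" "\<phi> \<noteq> \<psi>" "\<phi> \<noteq> \<rho>" for \<phi> \<psi>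
    proof (rule covered_by_Int[OF covered_by_same_meet[OF that(2-4)] covered_byD(1)[OF c(3)] that(1)])
      show "\<not> \<phi> \<subseteq> \<rho>" using covered_by_same_eq[OF that(2) c(3)] that(5) by blast
    qed
    from this[of \<phi> \<psi>] this[of \<psi> \<phi>] True c ne
    have "\<rho> \<inter> \<phi> = \<phi> \<inter> \<psi>" "\<rho> \<inter> \<psi> = \<phi> \<inter> \<psi>" by (auto simp: Int_commute)
    then have "\<rho> = \<chi>" unfolding \<chi>_def
      by (rule diagonal_eq_agree[OF MI(1) cov(1) c(2,3) ne(1)])
    then show ?thesis using l\<chi> linked_sym by simp
  next
    case False
    have "\<not> \<chi> \<inter> \<chi>' \<subseteq> \<phi>"
    proof
      assume le: "\<chi> \<inter> \<chi>' \<subseteq> \<phi>"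
      have "\<chi> \<inter> \<chi>' \<lless> \<chi>" by (rule covered_by_same_meet[OF c\<chi> c\<chi>' ne\<chi>])
      moreover have "\<phi> \<inter> \<psi> \<in> Cong" using MI MI_Cong by (intro Int_congruence) auto
      moreover have "\<chi> \<inter> \<chi>' \<subseteq> \<phi> \<inter> \<psi>" using le by (auto simp: \<chi>_def agree_def)
      moreover have "\<phi> \<inter> \<psi> \<subseteq> \<chi>" using sub by (auto simp: \<chi>_def agree_def)
      ultimately have "\<phi> \<inter> \<psi> = \<chi> \<inter> \<chi>' \<or> \<phi> \<inter> \<psi> = \<chi>" by (rule covered_byD(5))
      then show False
      proof
        assume "\<phi> \<inter> \<psi> = \<chi> \<inter> \<chi>'"
        then have "\<phi> \<inter> \<psi> \<subseteq> \<rho>" by (auto simp: \<chi>'_def agree_def)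
        with False show False ..
      next
        assume "\<phi> \<inter> \<psi> = \<chi>"
        then have "\<chi> = \<phi>" "\<chi> = \<psi>"
          using covered_by_same_eq[OF c\<chi> c(1)] covered_by_same_eq[OF c\<chi> c(2)] by auto
        with ne(1) show False by simp
      qed
    qed
    moreover have "\<chi> \<inter> \<chi>' \<in> Cong" using c\<chi> c\<chi>' covered_byD(1) by (intro Int_congruence) auto
    moreover have "\<chi> \<inter> \<chi>' \<inter> \<phi> = \<chi> \<inter> \<chi>' \<inter> \<rho>" by (auto simp: \<chi>_def \<chi>'_def agree_def)
    moreover have "\<chi> \<inter> \<chi>' \<subseteq> \<mu>" by (auto simp: \<chi>_def agree_def)
    ultimately show ?thesis using MI cov by (intro linkedI[of _ _ "\<chi> \<inter> \<chi>'"]) simp_all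
  qed
qed

lemma linked_if_common_lower_transpose:
  assumes "\<eta> \<in> MI" "\<eta>' \<in> MI" "\<beta> \<in> Cong" "\<beta> \<inter> \<eta> = \<alpha>" "\<beta> \<inter> \<eta>' = \<alpha>" "\<not> \<beta> \<subseteq> \<eta>" "\<beta> \<subseteq> cover \<eta>" "\<beta> \<subseteq> cover \<eta>'"
  shows "linked \<eta> \<eta>'"
  using assms by (intro linkedI[of _ _ \<beta>]) simp_all

lemma transposes_up_Con_iff:
  "transposes_up (Con ar A) (\<alpha>, \<beta>) (\<gamma>, \<delta>) \<longleftrightarrow>
     \<alpha> \<in> Cong \<and> \<beta> \<in> Cong \<and> \<gamma> \<in> Cong \<and> \<delta> \<in> Cong \<and> \<alpha> \<subseteq> \<beta> \<and> \<gamma> \<subseteq> \<delta> \<and> \<beta> \<inter> \<gamma> = \<alpha> \<and> \<beta> \<curlyvee> \<gamma> = \<delta>"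
  by (auto simp: transposes_up_def Con_meet[OF algebra_A] Con_join[OF algebra_A])

text \<open>
  Attach to an interval of two elements \<open>I[\<alpha>, \<beta>]\<close> the set \<open>N\<close> of all meet irreducibles \<open>\<eta>\<close> such that it transposes up to
  \<open>I[\<eta>, \<eta>\<^sup>+]\<close>. Any two members of \<open>N\<close> are linked, and \<open>N\<close> becomes smaller, but not empty, when the interval
  moves up. So all members of the sets \<open>N\<close> along a projectivity are linked to each other.
\<close>

lemma projective_imp_linked:
  assumes \<phi>: "\<phi> \<in> MI" and \<psi>: "\<psi> \<in> MI"
    and p: "projective (Con ar A) (\<phi>, cover \<phi>) (\<psi>, cover \<psi>)"
  shows "linked \<phi> \<psi>"
proof -
  define N where "N = (\<lambda>(\<alpha>, \<beta>). {\<eta> \<in> MI. \<beta> \<inter> \<eta> = \<alpha> \<and> \<not> \<beta> \<subseteq> \<eta> \<and> \<beta> \<subseteq> cover \<eta>})"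
  define Inv where "Inv = (\<lambda>J. fst J \<lless> snd J \<and> (\<forall>\<eta>\<in>N J. linked \<phi> \<eta>))"
  have N_linked: "linked \<eta> \<eta>'" if "\<eta> \<in> N (\<alpha>, \<beta>)" "\<eta>' \<in> N (\<alpha>, \<beta>)" "\<beta> \<in> Cong" for \<eta> \<eta>' \<alpha> \<beta>
    using that by (intro linked_if_common_lower_transpose[of _ _ \<beta> \<alpha>]) (auto simp: N_def)
  have N_mono: "N J \<subseteq> N I" if "transposes_up (Con ar A) I J" for I J
  proof
    fix \<eta> assume \<eta>: "\<eta> \<in> N J"
    obtain \<alpha> \<beta> \<gamma> \<delta> where IJ: "I = (\<alpha>, \<beta>)" "J = (\<gamma>, \<delta>)" by (cases I, cases J)
    have t: "\<beta> \<in> Cong" "\<gamma> \<in> Cong" "\<beta> \<inter> \<gamma> = \<alpha>" "\<beta> \<curlyvee> \<gamma> = \<delta>"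
      using that unfolding IJ transposes_up_Con_iff by blast+
    have n: "\<eta> \<in> MI" "\<delta> \<inter> \<eta> = \<gamma>" "\<not> \<delta> \<subseteq> \<eta>" "\<delta> \<subseteq> cover \<eta>"
      using \<eta> unfolding IJ N_def by auto
    have le: "\<beta> \<subseteq> \<delta>" using t(4) cong_join_upper(1) by metis
    then have "\<beta> \<inter> \<eta> = \<alpha>" using n(2) t(3) by blast
    moreover have "\<not> \<beta> \<subseteq> \<eta>"
    proof
      assume "\<beta> \<subseteq> \<eta>"
      then have "\<beta> \<curlyvee> \<gamma> \<subseteq> \<eta>" using n(1,2) MI_Cong by (intro cong_join_least) auto
      with t(4) n(3) show False by simp
    qed
    ultimately show "\<eta> \<in> N I" using n(1,4) le unfolding IJ N_def by auto
  qed
  have base: "Inv (\<phi>, cover \<phi>)"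
  proof -
    have "\<phi> \<in> N (\<phi>, cover \<phi>)" using cover_greater[OF \<phi>] \<phi> by (auto simp: N_def)
    then show ?thesis
      using N_linked cover_Cong[OF \<phi>] covered_by_cover[OF \<phi>] by (auto simp: Inv_def)
  qed
  have up: "Inv J" if "Inv I" "transposes_up (Con ar A) I J" for I J
  proof -
    obtain \<alpha> \<beta> \<gamma> \<delta> where IJ: "I = (\<alpha>, \<beta>)" "J = (\<gamma>, \<delta>)" by (cases I, cases J)
    have "\<gamma> \<lless> \<delta>"
      using that covered_by_transpose_up[of \<alpha> \<beta> \<gamma>] unfolding IJ transposes_up_Con_iff Inv_def by auto
    then show ?thesis using that(1) N_mono[OF that(2)] unfolding Inv_def IJ by auto
  qed
  have down: "Inv J" if "Inv I" "transposes_up (Con ar A) J I" for I J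
  proof -
    obtain \<alpha> \<beta> \<gamma> \<delta> where IJ: "J = (\<alpha>, \<beta>)" "I = (\<gamma>, \<delta>)" by (cases I, cases J)
    have c: "\<gamma> \<lless> \<delta>" using that(1) by (simp add: Inv_def IJ)
    have \<beta>: "\<beta> \<in> Cong" and "\<alpha> \<lless> \<beta>"
      using that covered_by_transpose_down[of \<gamma> \<beta>] c unfolding IJ transposes_up_Con_iff by auto
    obtain \<eta>' where n: "\<eta>' \<in> MI" "\<gamma> \<subseteq> \<eta>'" "\<not> \<delta> \<subseteq> \<eta>'" "\<delta> \<subseteq> cover \<eta>'"
      by (rule MI_separating[OF covered_byD(1,2,4)[OF c]])
    then have \<eta>': "\<eta>' \<in> N I"
      using covered_by_Int[OF c MI_Cong[OF n(1)]] unfolding IJ N_def by auto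
    have "linked \<phi> \<eta>" if "\<eta> \<in> N J" for \<eta>
    proof -
      have "linked \<eta>' \<eta>"
        using N_linked[of \<eta>' \<alpha> \<beta> \<eta>] \<eta>' N_mono[OF \<open>transposes_up _ J I\<close>] that \<beta> unfolding IJ by blast
      moreover have "linked \<phi> \<eta>'" using \<open>Inv I\<close> \<eta>' by (simp add: Inv_def)
      ultimately show ?thesis using linked_trans by blast
    qed
    with \<open>\<alpha> \<lless> \<beta>\<close> show ?thesis by (simp add: Inv_def IJ)
  qed
  have "Inv (\<psi>, cover \<psi>)"
    using p unfolding projective_def equivclp_def
    by (induction rule: rtranclp_induct) (auto elim!: symclpE intro: base up down)
  moreover have "\<psi> \<in> N (\<psi>, cover \<psi>)" using cover_greater[OF \<psi>] \<psi> by (auto simp: N_def)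
  ultimately show ?thesis by (simp add: Inv_def)
qed

lemma linked_imp_projective:
  assumes "linked \<phi> \<psi>"
  shows "projective (Con ar A) (\<phi>, cover \<phi>) (\<psi>, cover \<psi>)"
proof -
  obtain \<beta> where b: "\<phi> \<in> MI" "\<psi> \<in> MI" "\<beta> \<in> Cong" "\<beta> \<inter> \<phi> = \<beta> \<inter> \<psi>" "\<not> \<beta> \<subseteq> \<phi>" "\<not> \<beta> \<subseteq> \<psi>"
    "\<beta> \<subseteq> cover \<phi>" "\<beta> \<subseteq> cover \<psi>"
    using assms by (rule linkedE)
  have t: "transposes_up (Con ar A) (\<beta> \<inter> \<eta>, \<beta>) (\<eta>, cover \<eta>)"
    if "\<eta> \<in> MI" "\<not> \<beta> \<subseteq> \<eta>" "\<beta> \<subseteq> cover \<eta>" for \<eta>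
    using that b(3) covered_by_join[OF covered_by_cover[OF that(1)] b(3) that(3,2)] MI_cover[OF that(1)]
      cong_join_commute[of ar A \<beta> \<eta>]
    unfolding transposes_up_Con_iff by (auto intro: Int_congruence)
  show ?thesis
    unfolding projective_def
    using t[OF b(1,5,7)] t[OF b(2,6,8)] b(4)
    by (auto intro: equivclp_trans equivclp_sym r_into_equivclp)
qed

lemma Cm_sim_iff_linked: "(\<phi>, \<psi>) \<in> Cm_sim (Con ar A) \<longleftrightarrow> linked \<phi> \<psi>"
  using projective_imp_linked[of \<phi> \<psi>] linked_imp_projective[of \<phi> \<psi>] linked_MI[of \<phi> \<psi>]
  by (auto simp: Cm_sim_def)

end

section \<open>Counting the vectors of a finite space\<close>

lemma (in vectorspace) card_carrier_eq_power_dim: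
  assumes fin: "finite (carrier V)"
  shows "card (carrier V) = card (carrier K) ^ dim"
proof -
  have "gen_set (carrier V)"
    using span_is_subset2[of "carrier V"] in_own_span[of "carrier V"] by auto
  then have "fin_dim" using fin unfolding fin_dim_def by blast
  then obtain B where B: "finite B" "basis B" using finite_basis_exists by blast
  then have li: "lin_indpt B" and gen: "span B = carrier V" and sub: "B \<subseteq> carrier V"
    by (auto simp: basis_def)
  have "bij_betw (\<lambda>a. lincomb a B) (B \<rightarrow>\<^sub>E carrier K) (carrier V)"
    unfolding bij_betw_def
  proof
    show "inj_on (\<lambda>a. lincomb a B) (B \<rightarrow>\<^sub>E carrier K)"
    proof (rule inj_onI)
      fix a b assume a: "a \<in> B \<rightarrow>\<^sub>E carrier K" and b: "b \<in> B \<rightarrow>\<^sub>E carrier K"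
        and eq: "lincomb a B = lincomb b B"
      then have ab: "a \<in> B \<rightarrow> carrier K" "b \<in> B \<rightarrow> carrier K" by auto
      have "lincomb (\<lambda>v. a v \<ominus>\<^bsub>K\<^esub> b v) B = \<zero>\<^bsub>V\<^esub>"
        using lincomb_diff[OF B(1) sub ab] eq lincomb_closed[OF sub ab(2)] by (simp add: a_minus_def M.r_neg)
      moreover have "(\<lambda>v. a v \<ominus>\<^bsub>K\<^esub> b v) \<in> B \<rightarrow> carrier K" using ab by auto
      ultimately have "a v \<ominus>\<^bsub>K\<^esub> b v = \<zero>\<^bsub>K\<^esub>" if "v \<in> B" for v
        using li lin_dep_crit[OF B(1) order_refl _ that] by blast
      then have "a v = b v" if "v \<in> B" for v
        using ab that by (metis Pi_mem R.r_right_minus_eq)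
      with a b show "a = b" by (rule PiE_ext)
    qed
    show "(\<lambda>a. lincomb a B) ` (B \<rightarrow>\<^sub>E carrier K) = carrier V"
    proof
      show "(\<lambda>a. lincomb a B) ` (B \<rightarrow>\<^sub>E carrier K) \<subseteq> carrier V" using sub by auto
      show "carrier V \<subseteq> (\<lambda>a. lincomb a B) ` (B \<rightarrow>\<^sub>E carrier K)"
      proof
        fix v assume "v \<in> carrier V"
        then obtain a where a: "a \<in> B \<rightarrow> carrier K" "lincomb a B = v"
          using finite_in_span[OF B(1) sub] gen by blast
        have "lincomb (restrict a B) B = lincomb a B" by (rule lincomb_cong) (use sub a in auto)
        moreover have "restrict a B \<in> B \<rightarrow>\<^sub>E carrier K" using a by auto
        ultimately show "v \<in> (\<lambda>a. lincomb a B) ` (B \<rightarrow>\<^sub>E carrier K)" using a(2) by (metis imageI)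
      qed
    qed
  qed
  then have "card (carrier V) = card (B \<rightarrow>\<^sub>E carrier K)" by (metis bij_betw_same_card)
  also have "\<dots> = card (carrier K) ^ card B" using B(1) by (simp add: card_PiE)
  finally show ?thesis using dim_basis[OF B] by simp
qed

section \<open>The Boolean groups of the projectivity classes\<close>

context finite_strongly_Fregean
begin

abbreviation "projectivity_classes \<equiv> MI // Cm_sim (Con ar A)"

lemma finite_projectivity_classes: "finite projectivity_classes"
proof (rule finite_quotient)
  show "finite MI" by (rule finite_subset[OF _ finite_Cong]) (auto simp: Cm_def)
  show "Cm_sim (Con ar A) \<subseteq> MI \<times> MI" by (auto simp: Cm_sim_def)
qed

lemma Cm_sim_Image: "Cm_sim (Con ar A) `` {\<eta>} = {\<psi>. linked \<eta> \<psi>}"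
  using Cm_sim_iff_linked by auto

lemma class_of_MI: "\<eta> \<in> MI \<Longrightarrow> {\<psi>. linked \<eta> \<psi>} \<in> projectivity_classes"
  unfolding Cm_sim_Image[symmetric] by (rule quotientI)

lemma class_eq:
  assumes "U \<in> projectivity_classes" "\<eta> \<in> U"
  shows "U = {\<psi>. linked \<eta> \<psi>}"
proof -
  obtain \<eta>' where "U = {\<psi>. linked \<eta>' \<psi>}"
    using assms(1) unfolding quotient_def Cm_sim_Image by blast
  with assms(2) show ?thesis using linked_trans linked_sym by blast
qed

lemma class_cover_eq:
  assumes "U \<in> projectivity_classes" "\<eta> \<in> U"
  shows "class_cover ar A U = cover \<eta>"
proof -
  have "(SOME \<eta>. \<eta> \<in> U) \<in> U" using assms(2) by (rule someI)
  then show ?thesis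
    using class_eq[OF assms] linked_cover_eq unfolding class_cover_def by (metis mem_Collect_eq)
qed

lemma class_nonempty:
  assumes "U \<in> projectivity_classes"
  obtains \<eta> where "\<eta> \<in> U"
  using assms linked_refl unfolding quotient_def Cm_sim_Image by blast

lemma class_cover_Cong:
  assumes U: "U \<in> projectivity_classes"
  shows "class_cover ar A U \<in> Cong"
proof -
  obtain \<eta> where \<eta>: "\<eta> \<in> U" by (rule class_nonempty[OF U])
  then have "\<eta> \<in> MI" using class_eq[OF U \<eta>] linked_MI by blast
  then show ?thesis using class_cover_eq[OF U \<eta>] cover_Cong by simp
qed

lemma class_memD:
  assumes "U \<in> projectivity_classes" "\<eta> \<in> U"
  shows "\<eta> \<in> MI" "\<eta> \<in> Cong" "\<eta> \<lless> class_cover ar A U"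
proof -
  show "\<eta> \<in> MI" using class_eq[OF assms] assms(2) linked_MI by blast
  then show "\<eta> \<in> Cong" "\<eta> \<lless> class_cover ar A U"
    using MI_Cong covered_by_cover class_cover_eq[OF assms] by simp_all
qed

lemma bullet_eq_agree:
  assumes "U \<in> projectivity_classes"
  shows "bullet ar A U \<phi> \<psi> = agree (class_cover ar A U) \<phi> \<psi>"
  using congruence_subset[OF class_cover_Cong[OF assms]] by (auto simp: bullet_def agree_def)

lemma agree_simps:
  "\<phi> \<subseteq> \<mu> \<Longrightarrow> agree \<mu> \<phi> \<mu> = \<phi>" "agree \<mu> \<phi> \<phi> = \<mu>"
  "agree \<mu> \<phi> \<psi> = agree \<mu> \<psi> \<phi>" "agree \<mu> (agree \<mu> \<phi> \<psi>) \<rho> = agree \<mu> \<phi> (agree \<mu> \<psi> \<rho>)"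
  by (auto simp: agree_def)

text \<open>
  \<open>group_above U \<theta>\<close> is the subgroup of the Boolean group of \<open>U\<close> cut out by the congruence \<open>\<theta>\<close>. The
  unit belongs to it even if it does not contain \<open>\<theta>\<close>.
\<close>

definition group_above :: "'a rel set \<Rightarrow> 'a rel \<Rightarrow> 'a rel set" where
  "group_above U \<theta> = insert (class_cover ar A U) {\<eta> \<in> U. \<theta> \<subseteq> \<eta>}"

lemma finite_group_above: "U \<in> projectivity_classes \<Longrightarrow> finite (group_above U \<theta>)"
  by (rule finite_subset[OF _ finite_Cong]) (auto simp: group_above_def class_cover_Cong class_memD)

lemma group_above_bottom:
  "U \<in> projectivity_classes \<Longrightarrow> group_above U (Id_on (carrier A)) = U \<union> {class_cover ar A U}"
  using identity_subset_congruence class_memD(2) unfolding group_above_def by blast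

lemma agree_class_closed:
  assumes U: "U \<in> projectivity_classes"
    and \<phi>: "\<phi> \<in> U \<union> {class_cover ar A U}" and \<psi>: "\<psi> \<in> U \<union> {class_cover ar A U}"
  shows "agree (class_cover ar A U) \<phi> \<psi> \<in> U \<union> {class_cover ar A U}"
proof -
  let ?\<mu> = "class_cover ar A U"
  have sub: "\<theta> \<subseteq> ?\<mu>" if "\<theta> \<in> U \<union> {?\<mu>}" for \<theta>
    using that class_memD(3)[OF U] covered_byD(3) by blast
  consider "\<phi> = ?\<mu>" | "\<psi> = ?\<mu>" | "\<phi> = \<psi>" | "\<phi> \<in> U" "\<psi> \<in> U" "\<phi> \<noteq> \<psi>" using \<phi> \<psi> by blast
  then show ?thesis
  proof cases
    case 1
    then show ?thesis using agree_simps(1)[OF sub[OF \<psi>]] agree_simps(3)[of ?\<mu> ?\<mu> \<psi>] \<psi> by simp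
  next
    case 2
    then show ?thesis using agree_simps(1)[OF sub[OF \<phi>]] \<phi> by simp
  next
    case 3
    then show ?thesis by (simp add: agree_simps(2))
  next
    case 4
    then have "linked \<phi> \<psi>" using class_eq[OF U] by blast
    then have "linked (agree ?\<mu> \<phi> \<psi>) \<phi>"
      using linked_agree 4(3) class_cover_eq[OF U 4(1)] by metis
    then show ?thesis using class_eq[OF U 4(1)] linked_sym by blast
  qed
qed

lemma boolean_space_vectorspace:
  assumes U: "U \<in> projectivity_classes"
  shows "vectorspace (residue_ring 2) (boolean_space ar A U)"
proof -
  interpret R: residues_prime 2 "residue_ring (int 2)" by unfold_locales simp_all
  have K: "field (residue_ring 2)" using R.is_field by simp
  have K01: "a = 0 \<or> a = 1" if "a \<in> carrier (residue_ring 2)" for a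
    using that by (auto simp: residue_ring_def)
  let ?\<mu> = "class_cover ar A U"
  have sub: "\<theta> \<subseteq> ?\<mu>" if "\<theta> \<in> U \<union> {?\<mu>}" for \<theta>
    using that class_memD(3)[OF U] covered_byD(3) by blast
  have simps: "carrier (boolean_space ar A U) = U \<union> {?\<mu>}"
    "\<phi> \<oplus>\<^bsub>boolean_space ar A U\<^esub> \<psi> = agree ?\<mu> \<phi> \<psi>" "\<zero>\<^bsub>boolean_space ar A U\<^esub> = ?\<mu>"
    "a \<odot>\<^bsub>boolean_space ar A U\<^esub> \<phi> = (if a = 0 then ?\<mu> else \<phi>)" for a \<phi> \<psi>
    by (simp_all add: boolean_space_def bullet_eq_agree[OF U])
  have ring: "\<one>\<^bsub>residue_ring 2\<^esub> = 1" "a \<otimes>\<^bsub>residue_ring 2\<^esub> b = (a * b) mod 2"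
    "a \<oplus>\<^bsub>residue_ring 2\<^esub> b = (a + b) mod 2" for a b
    by (simp_all add: residue_ring_def)
  have "module (residue_ring 2) (boolean_space ar A U)"
  proof (rule module_criteria)
    show "cring (residue_ring 2)" using R.cring by simp
    show "\<forall>a v w. a \<in> carrier (residue_ring 2) \<and> v \<in> carrier (boolean_space ar A U) \<and>
        w \<in> carrier (boolean_space ar A U) \<longrightarrow>
        a \<odot>\<^bsub>boolean_space ar A U\<^esub> (v \<oplus>\<^bsub>boolean_space ar A U\<^esub> w) =
        a \<odot>\<^bsub>boolean_space ar A U\<^esub> v \<oplus>\<^bsub>boolean_space ar A U\<^esub> a \<odot>\<^bsub>boolean_space ar A U\<^esub> w"
      unfolding simps by (simp add: agree_simps(2))
    show "\<forall>a b v. a \<in> carrier (residue_ring 2) \<and> b \<in> carrier (residue_ring 2) \<and>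
        v \<in> carrier (boolean_space ar A U) \<longrightarrow>
        (a \<oplus>\<^bsub>residue_ring 2\<^esub> b) \<odot>\<^bsub>boolean_space ar A U\<^esub> v =
        a \<odot>\<^bsub>boolean_space ar A U\<^esub> v \<oplus>\<^bsub>boolean_space ar A U\<^esub> b \<odot>\<^bsub>boolean_space ar A U\<^esub> v"
    proof (intro allI impI)
      fix a b v
      assume "a \<in> carrier (residue_ring 2) \<and> b \<in> carrier (residue_ring 2) \<and>
        v \<in> carrier (boolean_space ar A U)"
      then have ab: "a = 0 \<or> a = 1" "b = 0 \<or> b = 1" and v: "v \<subseteq> ?\<mu>"
        using K01 sub unfolding simps by blast+
      show "(a \<oplus>\<^bsub>residue_ring 2\<^esub> b) \<odot>\<^bsub>boolean_space ar A U\<^esub> v =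
        a \<odot>\<^bsub>boolean_space ar A U\<^esub> v \<oplus>\<^bsub>boolean_space ar A U\<^esub> b \<odot>\<^bsub>boolean_space ar A U\<^esub> v"
        using ab agree_simps(1)[OF v] agree_simps(3)[of ?\<mu> ?\<mu> v] unfolding simps ring
        by (elim disjE) (simp_all add: agree_simps(2))
    qed
    show "\<forall>a b v. a \<in> carrier (residue_ring 2) \<and> b \<in> carrier (residue_ring 2) \<and>
        v \<in> carrier (boolean_space ar A U) \<longrightarrow>
        (a \<otimes>\<^bsub>residue_ring 2\<^esub> b) \<odot>\<^bsub>boolean_space ar A U\<^esub> v =
        a \<odot>\<^bsub>boolean_space ar A U\<^esub> (b \<odot>\<^bsub>boolean_space ar A U\<^esub> v)"
    proof (intro allI impI)
      fix a b v
      assume "a \<in> carrier (residue_ring 2) \<and> b \<in> carrier (residue_ring 2) \<and>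
        v \<in> carrier (boolean_space ar A U)"
      then have "a = 0 \<or> a = 1" "b = 0 \<or> b = 1" using K01 by blast+
      then show "(a \<otimes>\<^bsub>residue_ring 2\<^esub> b) \<odot>\<^bsub>boolean_space ar A U\<^esub> v =
        a \<odot>\<^bsub>boolean_space ar A U\<^esub> (b \<odot>\<^bsub>boolean_space ar A U\<^esub> v)"
        unfolding simps ring by (elim disjE) simp_all
    qed
    show "\<forall>v\<in>carrier (boolean_space ar A U). \<exists>w\<in>carrier (boolean_space ar A U).
        v \<oplus>\<^bsub>boolean_space ar A U\<^esub> w = \<zero>\<^bsub>boolean_space ar A U\<^esub>"
      unfolding simps using agree_simps(2) by blast
    show "\<forall>v w. v \<in> carrier (boolean_space ar A U) \<and> w \<in> carrier (boolean_space ar A U) \<longrightarrow>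
        v \<oplus>\<^bsub>boolean_space ar A U\<^esub> w \<in> carrier (boolean_space ar A U)"
      unfolding simps using agree_class_closed[OF U] by blast
    show "\<forall>v w. v \<in> carrier (boolean_space ar A U) \<and> w \<in> carrier (boolean_space ar A U) \<longrightarrow>
        v \<oplus>\<^bsub>boolean_space ar A U\<^esub> w = w \<oplus>\<^bsub>boolean_space ar A U\<^esub> v"
      unfolding simps using agree_simps(3) by blast
    show "\<forall>v w x. v \<in> carrier (boolean_space ar A U) \<and> w \<in> carrier (boolean_space ar A U) \<and>
        x \<in> carrier (boolean_space ar A U) \<longrightarrow>
        v \<oplus>\<^bsub>boolean_space ar A U\<^esub> w \<oplus>\<^bsub>boolean_space ar A U\<^esub> x =
        v \<oplus>\<^bsub>boolean_space ar A U\<^esub> (w \<oplus>\<^bsub>boolean_space ar A U\<^esub> x)"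
      unfolding simps using agree_simps(4) by blast
    show "\<forall>v\<in>carrier (boolean_space ar A U).
        v \<oplus>\<^bsub>boolean_space ar A U\<^esub> \<zero>\<^bsub>boolean_space ar A U\<^esub> = v"
      unfolding simps using agree_simps(1) sub by blast
  qed (auto simp: simps ring)
  then show ?thesis using K by (simp add: vectorspace_def)
qed

lemma card_boolean_group:
  assumes U: "U \<in> projectivity_classes"
  shows "card (U \<union> {class_cover ar A U}) =
    2 ^ vectorspace.dim (residue_ring 2) (boolean_space ar A U)"
proof -
  have c: "carrier (boolean_space ar A U) = U \<union> {class_cover ar A U}"
    by (simp add: boolean_space_def)
  have "finite (U \<union> {class_cover ar A U})"
    using finite_group_above[OF U, of "Id_on (carrier A)"] by (simp only: group_above_bottom[OF U])
  moreover have "card (carrier (residue_ring 2)) = 2" by (simp add: residue_ring_def)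
  ultimately show ?thesis
    using vectorspace.card_carrier_eq_power_dim[OF boolean_space_vectorspace[OF U]] c by simp
qed

section \<open>Climbing a maximal chain\<close>

lemma covered_by_subset_cover:
  assumes c: "\<alpha> \<lless> \<beta>" and \<eta>: "\<eta> \<in> MI" and le: "\<alpha> \<subseteq> \<eta>" and not_le: "\<not> \<beta> \<subseteq> \<eta>"
  shows "\<beta> \<subseteq> cover \<eta>"
proof -
  have up: "\<eta> \<lless> \<beta> \<curlyvee> \<eta>"
    using covered_by_transpose_up[OF c MI_Cong[OF \<eta>] covered_by_Int[OF c MI_Cong[OF \<eta>] le not_le]] .
  then have "cover \<eta> \<subseteq> \<beta> \<curlyvee> \<eta>"
    using covered_byD[OF up] by (intro cover_least[OF \<eta>]) auto
  then have "cover \<eta> = \<beta> \<curlyvee> \<eta>"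
    using covered_byD(5)[OF up cover_Cong[OF \<eta>]] cover_greater[OF \<eta>] by auto
  then show ?thesis using cong_join_upper(1) by metis
qed

text \<open>
  The map \<open>\<theta> \<mapsto> \<theta> \<bullet> \<eta>\<close> exchanges the elements that contain \<open>\<beta>\<close> with those that contain \<open>\<alpha>\<close> but
  not \<open>\<beta>\<close>: the latter all have the same intersection \<open>\<alpha>\<close> with \<open>\<beta>\<close>.
\<close>

lemma card_group_above_step:
  assumes c: "\<alpha> \<lless> \<beta>" and U: "U \<in> projectivity_classes"
    and \<eta>: "\<eta> \<in> U" and le: "\<alpha> \<subseteq> \<eta>" and not_le: "\<not> \<beta> \<subseteq> \<eta>"
  shows "card (group_above U \<alpha>) = 2 * card (group_above U \<beta>)"
proof -
  let ?\<mu> = "class_cover ar A U" and ?f = "\<lambda>\<theta>. agree (class_cover ar A U) \<theta> \<eta>"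
  have \<beta>\<mu>: "\<beta> \<subseteq> ?\<mu>"
    using covered_by_subset_cover[OF c class_memD(1)[OF U \<eta>] le not_le] class_cover_eq[OF U \<eta>] by simp
  have \<alpha>\<beta>: "\<alpha> \<subseteq> \<beta>" using covered_byD(3)[OF c] .
  have int: "\<beta> \<inter> \<theta> = \<alpha>" if "\<theta> \<in> U" "\<alpha> \<subseteq> \<theta>" "\<not> \<beta> \<subseteq> \<theta>" for \<theta>
    using that by (intro covered_by_Int[OF c class_memD(2)[OF U]])
  have sub: "\<theta> \<subseteq> ?\<mu>" if "\<theta> \<in> U \<union> {?\<mu>}" for \<theta>
    using that class_memD(3)[OF U] covered_byD(3) by blast
  have closed: "?f \<theta> \<in> U \<union> {?\<mu>}" if "\<theta> \<in> U \<union> {?\<mu>}" for \<theta>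
    using agree_class_closed[OF U that] \<eta> by blast
  have invol: "?f (?f \<theta>) = \<theta>" if "\<theta> \<in> U \<union> {?\<mu>}" for \<theta>
    using sub[OF that] by (auto simp: agree_def)
  have ga: "group_above U \<beta> = {\<theta> \<in> U \<union> {?\<mu>}. \<beta> \<subseteq> \<theta>}"
    using \<beta>\<mu> by (auto simp: group_above_def)
  have ga': "group_above U \<alpha> - group_above U \<beta> = {\<theta> \<in> U. \<alpha> \<subseteq> \<theta> \<and> \<not> \<beta> \<subseteq> \<theta>}"
    using \<beta>\<mu> by (auto simp: group_above_def)
  have "bij_betw ?f (group_above U \<beta>) (group_above U \<alpha> - group_above U \<beta>)"
    unfolding ga' unfolding ga
  proof (rule bij_betw_byWitness[where f' = ?f])
    show "\<forall>\<theta>\<in>{\<theta> \<in> U \<union> {?\<mu>}. \<beta> \<subseteq> \<theta>}. ?f (?f \<theta>) = \<theta>"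
      "\<forall>\<theta>\<in>{\<theta> \<in> U. \<alpha> \<subseteq> \<theta> \<and> \<not> \<beta> \<subseteq> \<theta>}. ?f (?f \<theta>) = \<theta>" using invol by auto
    show "?f ` {\<theta> \<in> U \<union> {?\<mu>}. \<beta> \<subseteq> \<theta>} \<subseteq> {\<theta> \<in> U. \<alpha> \<subseteq> \<theta> \<and> \<not> \<beta> \<subseteq> \<theta>}"
    proof (rule image_subsetI)
      fix \<theta> assume "\<theta> \<in> {\<theta> \<in> U \<union> {?\<mu>}. \<beta> \<subseteq> \<theta>}"
      then have \<theta>: "\<theta> \<in> U \<union> {?\<mu>}" "\<beta> \<subseteq> \<theta>" by simp_all
      have eq: "\<beta> \<inter> ?f \<theta> = \<alpha>" using int[OF \<eta> le not_le] \<theta>(2) \<beta>\<mu> by (auto simp: agree_def)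
      then have "\<not> \<beta> \<subseteq> ?f \<theta>" using covered_byD(4)[OF c] by blast
      moreover have "?f \<theta> \<in> U" using closed[OF \<theta>(1)] calculation \<beta>\<mu> by blast
      ultimately show "?f \<theta> \<in> {\<theta> \<in> U. \<alpha> \<subseteq> \<theta> \<and> \<not> \<beta> \<subseteq> \<theta>}" using eq by blast
    qed
    show "?f ` {\<theta> \<in> U. \<alpha> \<subseteq> \<theta> \<and> \<not> \<beta> \<subseteq> \<theta>} \<subseteq> {\<theta> \<in> U \<union> {?\<mu>}. \<beta> \<subseteq> \<theta>}"
    proof (rule image_subsetI)
      fix \<theta> assume "\<theta> \<in> {\<theta> \<in> U. \<alpha> \<subseteq> \<theta> \<and> \<not> \<beta> \<subseteq> \<theta>}"
      then have \<theta>: "\<theta> \<in> U" "\<alpha> \<subseteq> \<theta>" "\<not> \<beta> \<subseteq> \<theta>" by simp_all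
      have "\<beta> \<subseteq> ?f \<theta>" using int[OF \<eta> le not_le] int[OF \<theta>] \<beta>\<mu> by (auto simp: agree_def)
      then show "?f \<theta> \<in> {\<theta> \<in> U \<union> {?\<mu>}. \<beta> \<subseteq> \<theta>}" using closed \<theta>(1) by blast
    qed
  qed
  then have "card (group_above U \<alpha> - group_above U \<beta>) = card (group_above U \<beta>)"
    by (metis bij_betw_same_card)
  moreover have "group_above U \<beta> \<subseteq> group_above U \<alpha>" using \<alpha>\<beta> by (auto simp: group_above_def)
  ultimately show ?thesis
    using card_Diff_subset[of "group_above U \<beta>" "group_above U \<alpha>"] finite_group_above[OF U]
      card_mono[of "group_above U \<alpha>" "group_above U \<beta>"] by simp
qed

text \<open>
  The meet irreducibles that are lost at the step from \<open>\<alpha>\<close> to \<open>\<beta>\<close> are linked to each other by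
  the interval \<open>I[\<alpha>, \<beta>]\<close>, so exactly one class is affected.
\<close>

lemma prod_card_group_above_step:
  assumes c: "\<alpha> \<lless> \<beta>"
  shows "(\<Prod>U\<in>projectivity_classes. card (group_above U \<alpha>)) =
    2 * (\<Prod>U\<in>projectivity_classes. card (group_above U \<beta>))"
proof -
  note C = covered_byD(1,2,4)[OF c]
  obtain \<eta> where \<eta>: "\<eta> \<in> MI" "\<alpha> \<subseteq> \<eta>" "\<not> \<beta> \<subseteq> \<eta>" "\<beta> \<subseteq> cover \<eta>"
    by (rule MI_separating[OF C])
  define W where "W = {\<psi>. linked \<eta> \<psi>}"
  have W: "W \<in> projectivity_classes" "\<eta> \<in> W"
    unfolding W_def using class_of_MI[OF \<eta>(1)] linked_refl[OF \<eta>(1)] by simp_all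
  have other: "group_above U \<alpha> = group_above U \<beta>" if U: "U \<in> projectivity_classes" "U \<noteq> W" for U
  proof -
    have "\<beta> \<subseteq> \<theta>" if \<theta>: "\<theta> \<in> U" "\<alpha> \<subseteq> \<theta>" for \<theta>
    proof (rule ccontr)
      assume n: "\<not> \<beta> \<subseteq> \<theta>"
      note M = class_memD(1)[OF U(1) \<theta>(1)]
      have "linked \<eta> \<theta>"
        by (rule linked_if_common_lower_transpose[OF \<eta>(1) M C(2) covered_by_Int[OF c MI_Cong[OF \<eta>(1)] \<eta>(2,3)]
              covered_by_Int[OF c MI_Cong[OF M] \<theta>(2) n] \<eta>(3,4) covered_by_subset_cover[OF c M \<theta>(2) n]])
      then have "\<theta> \<in> W" by (simp add: W_def)
      then have "U = W" using class_eq[OF U(1) \<theta>(1)] class_eq[OF W(1)] by blast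
      with U(2) show False ..
    qed
    then show ?thesis using covered_byD(3)[OF c] by (auto simp: group_above_def)
  qed
  let ?f = "\<lambda>\<theta> U. card (group_above U \<theta>)"
  have "prod (?f \<alpha>) projectivity_classes = ?f \<alpha> W * prod (?f \<alpha>) (projectivity_classes - {W})"
    by (rule prod.remove[OF finite_projectivity_classes W(1)])
  also have "prod (?f \<alpha>) (projectivity_classes - {W}) = prod (?f \<beta>) (projectivity_classes - {W})"
    using other by (intro prod.cong) auto
  also have "?f \<alpha> W = 2 * ?f \<beta> W" by (rule card_group_above_step[OF c W \<eta>(2,3)])
  also have "2 * ?f \<beta> W * prod (?f \<beta>) (projectivity_classes - {W}) = 2 * prod (?f \<beta>) projectivity_classes"
    using prod.remove[OF finite_projectivity_classes W(1), of "?f \<beta>"] by simp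
  finally show ?thesis .
qed

lemma card_maximal_chain:
  assumes max: "pred_on.maxchain Cong (\<subseteq>) C"
  shows "(\<Sum>U\<in>projectivity_classes. vectorspace.dim (residue_ring 2) (boolean_space ar A U)) = card C - 1"
proof -
  have sub: "C \<subseteq> Cong" and chain: "\<And>\<theta> \<kappa>. \<theta> \<in> C \<Longrightarrow> \<kappa> \<in> C \<Longrightarrow> \<theta> \<subseteq> \<kappa> \<or> \<kappa> \<subseteq> \<theta>"
    using max by (auto simp: pred_on.maxchain_def pred_on.chain_def)
  have finC: "finite C" using sub finite_Cong by (rule finite_subset)
  have maximal: "\<theta> \<in> C" if "\<theta> \<in> Cong" "\<And>\<kappa>. \<kappa> \<in> C \<Longrightarrow> \<theta> \<subseteq> \<kappa> \<or> \<kappa> \<subseteq> \<theta>" for \<theta>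
  proof (rule ccontr)
    assume "\<theta> \<notin> C"
    then have "C \<subset> insert \<theta> C" by blast
    moreover have "x \<subseteq> y \<or> y \<subseteq> x" if "x \<in> insert \<theta> C" "y \<in> insert \<theta> C" for x y
      using that chain \<open>\<And>\<kappa>. \<kappa> \<in> C \<Longrightarrow> \<theta> \<subseteq> \<kappa> \<or> \<kappa> \<subseteq> \<theta>\<close> by (metis insertE order_refl)
    then have "pred_on.chain Cong (\<subseteq>) (insert \<theta> C)"
      unfolding pred_on.chain_def using sub that(1) by (simp del: insert_iff)
    ultimately show False using max by (auto simp: pred_on.maxchain_def)
  qed
  have top: "carrier A \<times> carrier A \<in> C"
    using full_congruence[OF algebra_A] sub congruence_subset by (intro maximal) blast+
  have bot: "Id_on (carrier A) \<in> C"
    using identity_congruence[OF algebra_A] sub identity_subset_congruence by (intro maximal) blast+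
  let ?P = "\<lambda>\<theta>. \<Prod>U\<in>projectivity_classes. card (group_above U \<theta>)"
  have "?P \<theta> = 2 ^ card {\<kappa> \<in> C. \<theta> \<subset> \<kappa>}" if "\<theta> \<in> C" for \<theta>
    using that
  proof (induction "card {\<kappa> \<in> C. \<theta> \<subset> \<kappa>}" arbitrary: \<theta> rule: less_induct)
    case (less \<theta>)
    have \<theta>: "\<theta> \<in> Cong" using less.prems sub by blast
    show ?case
    proof (cases "{\<kappa> \<in> C. \<theta> \<subset> \<kappa>} = {}")
      case True
      then have "\<theta> = carrier A \<times> carrier A"
        using top congruence_subset[OF \<theta>] by blast
      then have "group_above U \<theta> = {class_cover ar A U}" if "U \<in> projectivity_classes" for U
        using covered_byD[OF class_memD(3)[OF that]] congruence_subset[OF class_cover_Cong[OF that]]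
        unfolding group_above_def by blast
      then have "?P \<theta> = 1" by (intro prod.neutral) simp
      then show ?thesis unfolding True by simp
    next
      case False
      define M where "M = {\<kappa> \<in> C. \<theta> \<subset> \<kappa>}"
      have "finite M" "M \<noteq> {}" using finC False by (auto simp: M_def)
      then obtain \<kappa> where \<kappa>M: "\<kappa> \<in> M" and min: "\<forall>\<kappa>'\<in>M. \<kappa>' \<subseteq> \<kappa> \<longrightarrow> \<kappa> = \<kappa>'"
        using finite_has_minimal[of M] by auto
      have \<kappa>: "\<kappa> \<in> C" "\<theta> \<subset> \<kappa>" using \<kappa>M by (simp_all add: M_def)
      have least: "\<kappa> \<subseteq> \<kappa>'" if "\<kappa>' \<in> M" for \<kappa>'
        using chain[OF \<kappa>(1), of \<kappa>'] min that by (auto simp: M_def)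
      have c: "\<theta> \<lless> \<kappa>"
        unfolding covered_by_def
      proof (intro conjI ballI impI)
        fix \<chi> assume \<chi>: "\<chi> \<in> Cong" and le: "\<theta> \<subseteq> \<chi> \<and> \<chi> \<subseteq> \<kappa>"
        have "\<chi> \<in> C"
        proof (rule maximal[OF \<chi>])
          fix \<kappa>' assume k: "\<kappa>' \<in> C"
          show "\<chi> \<subseteq> \<kappa>' \<or> \<kappa>' \<subseteq> \<chi>"
          proof (cases "\<kappa>' \<subseteq> \<theta>")
            case False
            then have "\<kappa>' \<in> M" using chain[OF less.prems k] k by (auto simp: M_def)
            then show ?thesis using least le by blast
          qed (use le in blast)
        qed
        then show "\<chi> = \<theta> \<or> \<chi> = \<kappa>" using least[of \<chi>] le by (auto simp: M_def)
      qed (use \<kappa> sub \<theta> in auto)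
      have M: "M = insert \<kappa> {\<kappa>' \<in> C. \<kappa> \<subset> \<kappa>'}"
        using least \<kappa> by (auto simp: M_def)
      then have card: "card M = Suc (card {\<kappa>' \<in> C. \<kappa> \<subset> \<kappa>'})"
        using finC by simp
      then have "?P \<kappa> = 2 ^ card {\<kappa>' \<in> C. \<kappa> \<subset> \<kappa>'}"
        using less.hyps[OF _ \<kappa>(1)] by (simp add: M_def)
      then show ?thesis
        unfolding prod_card_group_above_step[OF c] M_def[symmetric] card by simp
    qed
  qed
  from this[OF bot] have "?P (Id_on (carrier A)) = 2 ^ card {\<kappa> \<in> C. Id_on (carrier A) \<subset> \<kappa>}" .
  moreover have "{\<kappa> \<in> C. Id_on (carrier A) \<subset> \<kappa>} = C - {Id_on (carrier A)}"
    using sub identity_subset_congruence by blast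
  then have "card {\<kappa> \<in> C. Id_on (carrier A) \<subset> \<kappa>} = card C - 1"
    using bot finC by simp
  moreover have "?P (Id_on (carrier A)) =
      (\<Prod>U\<in>projectivity_classes. 2 ^ vectorspace.dim (residue_ring 2) (boolean_space ar A U))"
    by (intro prod.cong refl) (simp only: group_above_bottom card_boolean_group)
  ultimately have "(2::nat) ^ (\<Sum>U\<in>projectivity_classes. vectorspace.dim (residue_ring 2) (boolean_space ar A U))
      = 2 ^ (card C - 1)"
    by (simp add: power_sum)
  then show ?thesis by simp
qed

end

theorem theorem19:
  fixes ar :: "'f \<Rightarrow> nat" and u :: "'f trm" and A :: "('f, 'a) ualg"
  assumes "strongly_Fregean ar u A"
    and "finite (carrier A)"
  shows "lattice_length (Con ar A) =
    (\<Sum>U \<in> Cm (Con ar A) // Cm_sim (Con ar A).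
       vectorspace.dim (residue_ring 2) (boolean_space ar A U))"
proof -
  interpret finite_strongly_Fregean ar u A using assms by unfold_locales
  have "\<exists>C. pred_on.maxchain (carrier (Con ar A)) (le (Con ar A)) C" by (rule pred_on.Hausdorff)
  then have "pred_on.maxchain Cong (\<subseteq>) (SOME C. pred_on.maxchain (carrier (Con ar A)) (le (Con ar A)) C)"
    by (metis (mono_tags, lifting) Con_simps(1,2) someI_ex)
  then show ?thesis unfolding lattice_length_def by (rule card_maximal_chain[symmetric])
qed

end
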